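(* Let $G$ be a connected graph and let $\mathcal{B}_0$ be the family of cycles in $G$ that are bigons defined by two geodesics between vertices. Then geodesics between vertices are stable in $G$ if and only if there exist constants $\varepsilon>0$ and $k,m\in\mathbb{N}$ such that $G$ is $\varepsilon$-densely $(k,m)$-chordal on $\mathcal{B}_0$.
   Context: Every edge of the connected graph $G$ has length $1$, interior points of edges are points of $G$, and $d$ is the induced shortest-path (length) metric on $G$, making $G$ a geodesic metric space. Geodesics between vertices are stable in $G$ if there is a constant $R\ge0$ such that, for any two vertices $a,b$ of $G$ and any geodesic $[ab]$, every geodesic $\sigma$ joining $a$ to $b$ satisfies $d_H(\sigma,[ab])\le R$, where $d_H$ is the Hausdorff distance. A bigon defined by two geodesics between vertices is the union of two geodesics joining the same pair of vertices of $G$. Paths are finite and simple. A cycle is a simple closed curve, given by a sequence of vertices all different except that the first and last coincide. $L(\cdot)$ denotes length. For a cycle $C$, $d_C$ denotes the length metric on $C$. A shortcut in $C$ is a path $\sigma$ in $G$ joining two vertices $p,q$ of $C$ with $L(\sigma)<d_C(p,q)$; it is strict if $\sigma\cap C=\{p,q\}$, and then $p,q$ are the shortcut vertices associated to $\sigma$. A subset $A$ of a metric space $(X,\rho)$ is $\varepsilon$-dense if for every $x\in X$ there is $a\in A$ with $\rho(a,x)<\varepsilon$. Given a family $\mathcal{F}$ of cycles, $G$ is $\varepsilon$-densely $(k,m)$-chordal on $\mathcal{F}$ if for every $C\in\mathcal{F}$ with $L(C)\ge k$ there exist strict shortcuts $\sigma_1,\dots,\sigma_r$ in $C$ with $L(\sigma_i)\le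 m$ for all $i$ whose associated shortcut vertices form an $\varepsilon$-dense subset of $(C,d_C)$. It is always assumed that $k\ge4$ and $k\ge 2m$. *)

theory Defs
  imports "HOL-Analysis.Analysis"
begin

section \<open>Simple graphs, walks, paths and cycles\<close>

text \<open>Graphs may be infinite and need not be locally finite. An edge is a two-element set of
  vertices.\<close>

definition simple_graph :: "'a set \<Rightarrow> 'a set set \<Rightarrow> bool" where
  "simple_graph V E \<longleftrightarrow> (\<forall>e\<in>E. e \<subseteq> V \<and> card e = 2)"

definition walk_edges :: "'a list \<Rightarrow> 'a set set" where
  "walk_edges p = {{p ! i, p ! Suc i} | i. Suc i < length p}"

definition walk_length :: "'a list \<Rightarrow> nat" where
  "walk_length p = length p - 1"

definition is_walk :: "'a set \<Rightarrow> 'a set set \<Rightarrow> 'a list \<Rightarrow> bool" where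
  "is_walk V E p \<longleftrightarrow> p \<noteq> [] \<and> set p \<subseteq> V \<and> walk_edges p \<subseteq> E"

definition is_path :: "'a set \<Rightarrow> 'a set set \<Rightarrow> 'a list \<Rightarrow> bool" where
  "is_path V E p \<longleftrightarrow> is_walk V E p \<and> distinct p"

definition connected_graph :: "'a set \<Rightarrow> 'a set set \<Rightarrow> bool" where
  "connected_graph V E \<longleftrightarrow> simple_graph V E \<and>
     (\<forall>a\<in>V. \<forall>b\<in>V. \<exists>p. is_path V E p \<and> hd p = a \<and> last p = b)"

text \<open>The first vertex is repeated at the end of the list, so that \<open>walk_length C\<close> is the number
  of edges of the cycle. The lower bound on the length of the cycle excludes \<open>[v]\<close> and the
  back-and-forth walk \<open>[u, v, u]\<close>, which are not simple closed curves.\<close>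

definition is_cycle :: "'a set \<Rightarrow> 'a set set \<Rightarrow> 'a list \<Rightarrow> bool" where
  "is_cycle V E C \<longleftrightarrow> is_walk V E C \<and> hd C = last C \<and> distinct (tl C) \<and> 3 \<le> walk_length C"


section \<open>The graph as a length space\<close>

text \<open>Points of the graph are represented by their barycentric coordinates with respect to the
  vertices. For \<open>t \<in> {0..1}\<close>, \<open>edge_point u v t\<close> is the point of the edge \<open>{u, v}\<close> at distance
  \<open>t\<close> from \<open>u\<close> along the edge; thus it equals \<open>edge_point v u (1 - t)\<close>.\<close>

definition vertex_point :: "'a \<Rightarrow> 'a \<Rightarrow> real" where
  "vertex_point v = (\<lambda>w. if w = v then 1 else 0)"

definition edge_point :: "'a \<Rightarrow> 'a \<Rightarrow> real \<Rightarrow> 'a \<Rightarrow> real" where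
  "edge_point u v t = (\<lambda>w. if w = u then 1 - t else if w = v then t else 0)"

definition graph_points :: "'a set \<Rightarrow> 'a set set \<Rightarrow> ('a \<Rightarrow> real) set" where
  "graph_points V E = vertex_point ` V \<union> {edge_point u v t | u v t. {u, v} \<in> E \<and> t \<in> {0..1}}"

text \<open>\<open>polygonal E x y l\<close>: some polygonal curve from \<open>x\<close> to \<open>y\<close>, made of finitely many segments
  each contained in a single edge of unit length, has length \<open>l\<close>.\<close>

inductive polygonal :: "'a set set \<Rightarrow> ('a \<Rightarrow> real) \<Rightarrow> ('a \<Rightarrow> real) \<Rightarrow> real \<Rightarrow> bool"
  for E :: "'a set set" where
  polygonal_refl: "polygonal E x x 0"
| polygonal_step: "{u, v} \<in> E \<Longrightarrow> s \<in> {0..1} \<Longrightarrow> t \<in> {0..1} \<Longrightarrow> polygonal E (edge_point u v t) y l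
    \<Longrightarrow> polygonal E (edge_point u v s) y (\<bar>s - t\<bar> + l)"

text \<open>The induced length metric; it is meaningful for points of a connected graph only.\<close>

definition graph_dist :: "'a set set \<Rightarrow> ('a \<Rightarrow> real) \<Rightarrow> ('a \<Rightarrow> real) \<Rightarrow> real" where
  "graph_dist E x y = Inf {l. polygonal E x y l}"

definition is_geodesic ::
  "'a set \<Rightarrow> 'a set set \<Rightarrow> ('a \<Rightarrow> real) \<Rightarrow> ('a \<Rightarrow> real) \<Rightarrow> ('a \<Rightarrow> real) set \<Rightarrow> bool" where
  "is_geodesic V E x y S \<longleftrightarrow>
     (\<exists>L \<gamma>. 0 \<le> L \<and> \<gamma> 0 = x \<and> \<gamma> L = y \<and> S = \<gamma> ` {0..L} \<and> S \<subseteq> graph_points V E \<and>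
        (\<forall>s\<in>{0..L}. \<forall>t\<in>{0..L}. graph_dist E (\<gamma> s) (\<gamma> t) = \<bar>s - t\<bar>))"

definition hausdorff_dist :: "('p \<Rightarrow> 'p \<Rightarrow> real) \<Rightarrow> 'p set \<Rightarrow> 'p set \<Rightarrow> real" where
  "hausdorff_dist d A B = max (SUP x\<in>A. INF y\<in>B. d x y) (SUP y\<in>B. INF x\<in>A. d x y)"

definition vertex_geodesics_stable :: "'a set \<Rightarrow> 'a set set \<Rightarrow> bool" where
  "vertex_geodesics_stable V E \<longleftrightarrow>
     (\<exists>R\<ge>0. \<forall>a\<in>V. \<forall>b\<in>V. \<forall>S T.
        is_geodesic V E (vertex_point a) (vertex_point b) S \<longrightarrow>
        is_geodesic V E (vertex_point a) (vertex_point b) T \<longrightarrow>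
        hausdorff_dist (graph_dist E) T S \<le> R)"


section \<open>Dense chordality\<close>

text \<open>The points of \<open>G\<close> lying on a walk. A walk is itself a connected graph; in particular the
  length metric of a cycle \<open>C\<close> on \<open>walk_points C\<close> is \<open>graph_dist (walk_edges C)\<close>.\<close>

definition walk_points :: "'a list \<Rightarrow> ('a \<Rightarrow> real) set" where
  "walk_points p = graph_points (set p) (walk_edges p)"

definition is_shortcut :: "'a set \<Rightarrow> 'a set set \<Rightarrow> 'a list \<Rightarrow> 'a list \<Rightarrow> bool" where
  "is_shortcut V E C \<sigma> \<longleftrightarrow> is_path V E \<sigma> \<and> hd \<sigma> \<in> set C \<and> last \<sigma> \<in> set C \<and>
     real (walk_length \<sigma>)
       < graph_dist (walk_edges C) (vertex_point (hd \<sigma>)) (vertex_point (last \<sigma>))"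

definition is_strict_shortcut :: "'a set \<Rightarrow> 'a set set \<Rightarrow> 'a list \<Rightarrow> 'a list \<Rightarrow> bool" where
  "is_strict_shortcut V E C \<sigma> \<longleftrightarrow> is_shortcut V E C \<sigma> \<and>
     walk_points \<sigma> \<inter> walk_points C = {vertex_point (hd \<sigma>), vertex_point (last \<sigma>)}"

definition eps_dense :: "real \<Rightarrow> ('p \<Rightarrow> 'p \<Rightarrow> real) \<Rightarrow> 'p set \<Rightarrow> 'p set \<Rightarrow> bool" where
  "eps_dense \<epsilon> \<rho> X A \<longleftrightarrow> A \<subseteq> X \<and> (\<forall>x\<in>X. \<exists>a\<in>A. \<rho> a x < \<epsilon>)"

definition densely_chordal_on ::
  "'a set \<Rightarrow> 'a set set \<Rightarrow> real \<Rightarrow> nat \<Rightarrow> nat \<Rightarrow> 'a list set \<Rightarrow> bool" where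
  "densely_chordal_on V E \<epsilon> k m F \<longleftrightarrow>
     (\<forall>C\<in>F. k \<le> walk_length C \<longrightarrow>
        (\<exists>\<Sigma>. finite \<Sigma> \<and> (\<forall>\<sigma>\<in>\<Sigma>. is_strict_shortcut V E C \<sigma> \<and> walk_length \<sigma> \<le> m) \<and>
           eps_dense \<epsilon> (graph_dist (walk_edges C)) (walk_points C)
             (\<Union>\<sigma>\<in>\<Sigma>. {vertex_point (hd \<sigma>), vertex_point (last \<sigma>)})))"

definition geodesic_bigon_cycles :: "'a set \<Rightarrow> 'a set set \<Rightarrow> 'a list set" where
  "geodesic_bigon_cycles V E =
     {C. is_cycle V E C \<and>
        (\<exists>a\<in>V. \<exists>b\<in>V. \<exists>S T.
           is_geodesic V E (vertex_point a) (vertex_point b) S \<and>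
           is_geodesic V E (vertex_point a) (vertex_point b) T \<and>
           walk_points C = S \<union> T)}"

end

theory Submission
  imports Defs
begin

text \<open>Why the equivalence holds. The graph has edges of unit length, so the distance from a vertex
  \<open>a\<close> to the point at distance \<open>t\<close> from \<open>u\<close> on an edge \<open>{u, v}\<close> is
  \<open>min (D a u + t) (D a v + 1 - t)\<close>, where \<open>D\<close> counts edges of shortest walks
  (\<open>graph_dist_vertex_edge\<close>); it is never an integer in the interior of an edge. Along a geodesic
  that starts in \<open>a\<close> the distance from \<open>a\<close> grows with unit speed, so the geodesic is at a vertex at
  every integral time. Hence a geodesic between vertices is a vertex sequence \<open>p\<close> with \<open>D (p i) (p j) = j - i\<close>
  for \<open>i \<le> j\<close> together with the edges between consecutive vertices (\<open>geodesicE\<close>), and two geodesics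
  between the same endpoints can meet in a vertex only at equal indices. After that everything is
  combinatorics of two sequences \<open>p\<close> and \<open>q\<close>.

  Dense chordality implies stability. A vertex \<open>p i\<close> outside \<open>q\<close> lies on the cycle formed by \<open>p\<close> and
  \<open>q\<close> between the two nearest common vertices, which is again a geodesic bigon. If that cycle is
  short, \<open>p i\<close> is close to such a common vertex. Otherwise some shortcut vertex is within \<open>\<epsilon>\<close> of
  \<open>p i\<close>. The two ends of a shortcut cannot both lie on \<open>p\<close>, since \<open>p\<close> is itself a shortest
  connection and runs inside the cycle; so one of them lies on \<open>q\<close>, and \<open>p i\<close> is within
  \<open>\<epsilon> + m\<close> of \<open>q\<close> (\<open>vertex_close_of_chordal\<close>).

  Stability implies dense chordality. Let the cycle be the bigon of \<open>p\<close> and \<open>q\<close>, both of length \<open>n\<close>,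
  and let every vertex of one side be within \<open>R\<close> of the other side. The two sides have only their
  endpoints in common: each of the two arcs of the cycle between these endpoints passes
  through every level of the distance from \<open>p 0\<close>, so each level strictly between \<open>0\<close> and \<open>n\<close>
  contains two vertices (\<open>cycle_level_not_single\<close>). Therefore a walk inside the cycle from one side
  to the other passes through an endpoint and is long when it starts far from the endpoints
  (\<open>cycle_dist_ge\<close>), whereas a shortest path in the graph has length at most \<open>R\<close>. Among the short
  connections close to a given vertex, one of minimal length meets the cycle only in its ends
  and is a strict shortcut (\<open>strict_shortcut_near\<close>). Every vertex of a long cycle is within
  \<open>2 R\<close> of a vertex that is far enough from the endpoints, which gives density.\<close>

section \<open>Numbers of edges of shortest walks\<close>

definition adj :: "'a set set \<Rightarrow> ('a \<times> 'a) set" where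
  "adj E = {(u, v). {u, v} \<in> E}"

definition step_dist :: "'a set set \<Rightarrow> 'a \<Rightarrow> 'a \<Rightarrow> nat" where
  "step_dist E a b = (LEAST n. (a, b) \<in> adj E ^^ n)"

lemma step_dist_le: "(a, b) \<in> adj E ^^ n \<Longrightarrow> step_dist E a b \<le> n"
  unfolding step_dist_def by (rule Least_le)

lemma adj_relpow_sym: "(a, b) \<in> adj E ^^ n \<Longrightarrow> (b, a) \<in> adj E ^^ n"
proof (induction n arbitrary: b)
  case (Suc n)
  then obtain c where "(a, c) \<in> adj E ^^ n" "(c, b) \<in> adj E" by auto
  with Suc.IH[of c] have "(b, c) \<in> adj E" "(c, a) \<in> adj E ^^ n"
    by (auto simp: adj_def insert_commute)
  then show ?case by (meson relpow_Suc_I2)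
qed auto

lemma adj_relpow_fun:
  "(\<And>i. i < n \<Longrightarrow> {f i, f (Suc i)} \<in> E) \<Longrightarrow> (f 0, f n) \<in> adj E ^^ n"
  by (subst relpow_fun_conv) (auto simp: adj_def)

lemma adj_relpow_segment:
  assumes "\<And>l. i \<le> l \<Longrightarrow> l < j \<Longrightarrow> {f l, f (Suc l)} \<in> E" "i \<le> j"
  shows "(f i, f j) \<in> adj E ^^ (j - i)"
  using adj_relpow_fun[of "j - i" "\<lambda>l. f (i + l)" E] assms by auto

lemma step_dist_commute: "step_dist E a b = step_dist E b a"
  unfolding step_dist_def by (metis adj_relpow_sym)

lemma step_dist_self [simp]: "step_dist E a a = 0"
  using step_dist_le[where a = a and b = a and n = 0] by simp

section \<open>Polygonal curves and points of a graph\<close>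

lemma edge_point_0 [simp]: "edge_point u v 0 = vertex_point u"
  by (auto simp: edge_point_def vertex_point_def)

lemma edge_point_1: "u \<noteq> v \<Longrightarrow> edge_point u v 1 = vertex_point v"
  by (auto simp: edge_point_def vertex_point_def)

lemma edge_point_swap: "u \<noteq> v \<Longrightarrow> edge_point v u t = edge_point u v (1 - t)"
  by (auto simp: edge_point_def)

lemma vertex_point_inject [simp]: "vertex_point u = vertex_point v \<longleftrightarrow> u = v"
  by (metis vertex_point_def zero_neq_one)

lemma polygonal_trans:
  "polygonal E x y l \<Longrightarrow> polygonal E y z m \<Longrightarrow> polygonal E x z (l + m)"
  by (induction rule: polygonal.induct) (auto simp: add.assoc intro: polygonal_step)

lemma polygonal_edge:
  assumes "{u, v} \<in> E" "s \<in> {0..1}" "t \<in> {0..1}"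
  shows "polygonal E (edge_point u v s) (edge_point u v t) \<bar>s - t\<bar>"
  using polygonal_step[OF assms polygonal_refl] by simp

lemma polygonal_sym: "polygonal E x y l \<Longrightarrow> polygonal E y x l"
proof (induction rule: polygonal.induct)
  case (polygonal_step u v s t y l)
  then show ?case
    using polygonal_trans[OF polygonal_step.IH polygonal_edge[of u v E t s]]
    by (simp add: add.commute abs_minus_commute)
qed (rule polygonal_refl)

lemma polygonal_nonneg: "polygonal E x y l \<Longrightarrow> 0 \<le> l"
  by (induction rule: polygonal.induct) auto

lemma graph_dist_le: "polygonal E x y l \<Longrightarrow> graph_dist E x y \<le> l"
  unfolding graph_dist_def by (rule cInf_lower) (auto intro: bdd_belowI polygonal_nonneg)

lemma graph_dist_commute: "graph_dist E x y = graph_dist E y x"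
  unfolding graph_dist_def by (rule arg_cong[where f = Inf]) (auto intro: polygonal_sym)

lemma graph_dist_nonneg: "polygonal E x y l \<Longrightarrow> 0 \<le> graph_dist E x y"
  unfolding graph_dist_def by (rule cInf_greatest) (auto intro: polygonal_nonneg)

lemma simple_graph_edgeD:
  assumes "simple_graph V E" "{u, v} \<in> E" shows "u \<in> V" "v \<in> V" "u \<noteq> v"
  using assms by (auto simp: simple_graph_def)

text \<open>Vertices and interior points of edges are separated, since the endpoints of an edge are also
  points of that edge.\<close>

lemma graph_points_cases:
  assumes "simple_graph V E" "x \<in> graph_points V E"
  obtains (vertex) v where "v \<in> V" "x = vertex_point v"
  | (edge) u v t where "{u, v} \<in> E" "0 < t" "t < 1" "x = edge_point u v t"
proof (cases "x \<in> vertex_point ` V")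
  case False
  then obtain u v t where *: "{u, v} \<in> E" "t \<in> {0..1}" "x = edge_point u v t"
    using assms by (auto simp: graph_points_def)
  with False simple_graph_edgeD[OF assms(1) *(1)] have "t \<noteq> 0" "t \<noteq> 1" by (auto simp: edge_point_1)
  with *(2) have "0 < t" "t < 1" by auto
  with * edge show thesis by blast
qed (use vertex in blast)

text \<open>A graph can be recovered from its set of points: a point determines the set of vertices at
  which its coordinates do not vanish, which is \<open>{u, v}\<close> for an interior point of the edge
  \<open>{u, v}\<close>.\<close>

lemma vertex_in_graph_points_iff:
  assumes "simple_graph V E"
  shows "vertex_point w \<in> graph_points V E \<longleftrightarrow> w \<in> V"
proof
  assume "vertex_point w \<in> graph_points V E"
  with assms show "w \<in> V"
  proof (cases rule: graph_points_cases)
    case (edge u v t)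
    then have "vertex_point w u = 1 - t" by (simp add: edge_point_def)
    with edge(3) have "u = w" by (simp add: vertex_point_def split: if_splits)
    then show ?thesis using simple_graph_edgeD[OF assms edge(1)] by simp
  qed simp
qed (simp add: graph_points_def)

lemma support_edge_point: "0 < t \<Longrightarrow> t < 1 \<Longrightarrow> u \<noteq> v \<Longrightarrow> {w. edge_point u v t w \<noteq> 0} = {u, v}"
  by (auto simp: edge_point_def)

lemma edge_in_graph_points_iff:
  assumes "simple_graph V E" "0 < t" "t < 1" "u \<noteq> v"
  shows "edge_point u v t \<in> graph_points V E \<longleftrightarrow> {u, v} \<in> E"
proof
  assume "edge_point u v t \<in> graph_points V E"
  with assms(1) show "{u, v} \<in> E"
  proof (cases rule: graph_points_cases)
    case (vertex w)
    have "{x. vertex_point w x \<noteq> 0} = {w}" by (auto simp: vertex_point_def)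
    with support_edge_point[OF assms(2-4)] vertex assms(4) show ?thesis by auto
  next
    case (edge u' v' t')
    have "{u, v} = {u', v'}"
      using support_edge_point[OF assms(2-4)] support_edge_point[of t' u' v'] edge
        simple_graph_edgeD[OF assms(1) edge(1)] by simp
    with edge show ?thesis by simp
  qed
next
  assume "{u, v} \<in> E"
  then show "edge_point u v t \<in> graph_points V E"
    using assms unfolding graph_points_def by fastforce
qed

lemma polygonal_mono: "polygonal E x y l \<Longrightarrow> E \<subseteq> E' \<Longrightarrow> polygonal E' x y l"
  by (induction rule: polygonal.induct) (auto intro: polygonal_refl polygonal_step)

lemma vertex_near_point:
  assumes "simple_graph V E" "x \<in> graph_points V E"
  obtains u l where "u \<in> V" "polygonal E (vertex_point u) x l" "l \<le> 1"
  using assms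
proof (cases rule: graph_points_cases)
  case (vertex v)
  then show ?thesis using that[of v 0] by (simp add: polygonal_refl)
next
  case (edge u v t)
  then show ?thesis
    using that[of u t] polygonal_edge[OF edge(1), of 0 t] simple_graph_edgeD[OF assms(1) edge(1)]
    by simp
qed

section \<open>Distances from a vertex\<close>

text \<open>The distance from \<open>a\<close> to \<open>x\<close>, read off from the barycentric coordinates of \<open>x\<close>: the minimum, over
  the one or two vertices \<open>w\<close> that carry \<open>x\<close>, of the length of a shortest walk to \<open>w\<close> continued by
  the segment from \<open>w\<close> to \<open>x\<close>, whose length is \<open>1 - x w\<close>. Since it refers to the coordinates only,
  it does not depend on how \<open>x\<close> is written as a point of an edge.\<close>

definition potential :: "'a set set \<Rightarrow> 'a \<Rightarrow> ('a \<Rightarrow> real) \<Rightarrow> real" where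
  "potential E a x = Inf {real (step_dist E a w) + 1 - x w | w. x w > 0}"

text \<open>Besides the ambient graph, the vertices and edges of a cycle form an instance; the metric of the
  cycle is then the metric of that instance.\<close>

locale conn_graph =
  fixes V :: "'a set" and E :: "'a set set"
  assumes simple: "simple_graph V E"
    and reachable: "a \<in> V \<Longrightarrow> b \<in> V \<Longrightarrow> \<exists>n. (a, b) \<in> adj E ^^ n"
begin

abbreviation D where "D \<equiv> step_dist E"

lemmas edgeD = simple_graph_edgeD[OF simple]

lemma D_attained: "a \<in> V \<Longrightarrow> b \<in> V \<Longrightarrow> (a, b) \<in> adj E ^^ D a b"
  unfolding step_dist_def by (rule LeastI_ex[OF reachable])

lemma D_triangle: "a \<in> V \<Longrightarrow> b \<in> V \<Longrightarrow> c \<in> V \<Longrightarrow> D a c \<le> D a b + D b c"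
  by (intro step_dist_le) (auto simp: relpow_add intro: D_attained)

lemma D_0_iff: "a \<in> V \<Longrightarrow> b \<in> V \<Longrightarrow> D a b = 0 \<longleftrightarrow> a = b"
  using D_attained[of a b] by auto

lemma D_edge: "{u, v} \<in> E \<Longrightarrow> D u v = 1"
  using edgeD[of u v] D_0_iff[of u v] step_dist_le[where a = u and b = v and n = 1] by (force simp: adj_def)

lemma adjacent_of_D_1: "a \<in> V \<Longrightarrow> b \<in> V \<Longrightarrow> D a b = 1 \<Longrightarrow> {a, b} \<in> E"
  using D_attained[of a b] by (auto simp: adj_def)

lemma D_edge_le:
  assumes "a \<in> V" "{u, v} \<in> E"
  shows "D a u \<le> D a v + 1" "D a v \<le> D a u + 1"
  using D_triangle[of a u v] D_triangle[of a v u] D_edge[of u v] assms edgeD[of u v]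
  by (auto simp: step_dist_commute[of E v u])

lemma potential_vertex: "potential E a (vertex_point b) = real (D a b)"
proof -
  have "{real (D a w) + 1 - vertex_point b w | w. vertex_point b w > 0} = {real (D a b)}"
    by (auto simp: vertex_point_def)
  then show ?thesis by (simp add: potential_def)
qed

lemma potential_edge:
  assumes "a \<in> V" "{u, v} \<in> E" "t \<in> {0..1}"
  shows "potential E a (edge_point u v t) = min (real (D a u) + t) (real (D a v) + 1 - t)"
proof -
  note ne = edgeD(3)[OF assms(2)] and le = D_edge_le[OF assms(1,2)]
  consider "t = 0" | "t = 1" | "0 < t" "t < 1" using assms(3) by fastforce
  then show ?thesis
  proof cases
    case 3
    have "{real (D a w) + 1 - edge_point u v t w | w. edge_point u v t w > 0}
       = {real (D a u) + t, real (D a v) + 1 - t}"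
      using 3 ne by (auto simp: edge_point_def)
    then show ?thesis by (simp add: potential_def cInf_eq_Min)
  qed (use ne le in \<open>auto simp: potential_vertex edge_point_1\<close>)
qed

text \<open>On one edge the potential is a minimum of two affine functions of slope \<open>1\<close> and \<open>-1\<close>, hence
  1-Lipschitz, and a polygonal curve is a concatenation of segments in edges. This is the lower
  bound that identifies the infimum in the definition of the distance.\<close>

lemma potential_lipschitz:
  assumes "polygonal E x y l" "a \<in> V"
  shows "potential E a y - potential E a x \<le> l"
  using assms
proof (induction rule: polygonal.induct)
  case (polygonal_step u v s t y l)
  have "potential E a (edge_point u v t) - potential E a (edge_point u v s) \<le> \<bar>s - t\<bar>"
    using polygonal_step by (simp add: potential_edge)
  with polygonal_step show ?case by simp
qed simp

lemma polygonal_relpow: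
  "(a, b) \<in> adj E ^^ n \<Longrightarrow> polygonal E (vertex_point a) (vertex_point b) (real n)"
proof (induction n arbitrary: b)
  case 0 then show ?case by (simp add: polygonal_refl)
next
  case (Suc n)
  then obtain c where c: "(a, c) \<in> adj E ^^ n" "{c, b} \<in> E" by (auto simp: adj_def)
  have "polygonal E (vertex_point c) (vertex_point b) 1"
    using polygonal_edge[OF c(2), of 0 1] edgeD[OF c(2)] by (simp add: edge_point_1)
  from polygonal_trans[OF Suc.IH[OF c(1)] this] show ?case by (simp add: add.commute)
qed

lemma polygonal_vertices:
  "a \<in> V \<Longrightarrow> b \<in> V \<Longrightarrow> polygonal E (vertex_point a) (vertex_point b) (real (D a b))"
  by (intro polygonal_relpow D_attained)

lemma polygonal_vertex_edge:
  assumes "a \<in> V" "{u, v} \<in> E" "t \<in> {0..1}"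
  shows "polygonal E (vertex_point a) (edge_point u v t) (real (D a u) + t)"
  using polygonal_trans[OF polygonal_vertices[of a u] polygonal_edge[OF assms(2), of 0 t, simplified]]
    edgeD[OF assms(2)] assms by simp

lemma graph_dist_vertex_eqI:
  assumes "a \<in> V" "polygonal E (vertex_point a) x (potential E a x)"
  shows "graph_dist E (vertex_point a) x = potential E a x"
  unfolding graph_dist_def using assms potential_lipschitz[of "vertex_point a" x _ a]
  by (intro cInf_eq_minimum) (auto simp: potential_vertex)

lemma graph_dist_vertices:
  "a \<in> V \<Longrightarrow> b \<in> V \<Longrightarrow> graph_dist E (vertex_point a) (vertex_point b) = real (D a b)"
  by (subst graph_dist_vertex_eqI) (auto simp: potential_vertex polygonal_vertices)

lemma graph_dist_vertex_edge:
  assumes "a \<in> V" "{u, v} \<in> E" "t \<in> {0..1}"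
  shows "graph_dist E (vertex_point a) (edge_point u v t)
    = min (real (D a u) + t) (real (D a v) + 1 - t)"
proof -
  have vu: "{v, u} \<in> E" "1 - t \<in> {0..1}" using assms by (auto simp: insert_commute)
  have "polygonal E (vertex_point a) (edge_point u v t) (real (D a v) + 1 - t)"
    using polygonal_vertex_edge[OF assms(1) vu] edgeD[OF assms(2)]
    by (simp add: edge_point_swap[of u v "1 - t"] add_diff_eq)
  with polygonal_vertex_edge[OF assms] 
  show ?thesis
    by (subst graph_dist_vertex_eqI) (auto simp: potential_edge[OF assms] assms min_def)
qed

text \<open>By the formula for the distance from a vertex, passing from a point of an edge to a suitable one of
  its endpoints does not increase the distance from \<open>a\<close>.\<close>

lemma subgraph_vertex_close:
  assumes "simple_graph V' E'" "E' \<subseteq> E" "V' \<subseteq> V" "y \<in> graph_points V' E'" "a \<in> V"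
  obtains u where "u \<in> V'" "real (D a u) \<le> graph_dist E (vertex_point a) y"
  using assms(1,4)
proof (cases rule: graph_points_cases)
  case (vertex v)
  then show ?thesis using that[of v] assms graph_dist_vertices[of a v] by auto
next
  case (edge u v t)
  have "graph_dist E (vertex_point a) y = min (real (D a u) + t) (real (D a v) + 1 - t)"
    using edge assms by (subst edge(4), intro graph_dist_vertex_edge) auto
  then have "real (D a u) \<le> graph_dist E (vertex_point a) y \<or> real (D a v) \<le> graph_dist E (vertex_point a) y"
    using edge by (auto simp: min_def)
  then show ?thesis
    using that[of u] that[of v] simple_graph_edgeD[OF assms(1) edge(1)] by auto
qed

section \<open>Geodesics between vertices as vertex sequences\<close>

definition geodesic_seq :: "nat \<Rightarrow> (nat \<Rightarrow> 'a) \<Rightarrow> bool" where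
  "geodesic_seq n p \<longleftrightarrow>
    (\<forall>i\<le>n. p i \<in> V) \<and> (\<forall>i<n. {p i, p (Suc i)} \<in> E) \<and> D (p 0) (p n) = n"

text \<open>A proper shortcut between \<open>p i\<close> and \<open>p j\<close> would give a walk from \<open>p 0\<close> to \<open>p n\<close> of length less
  than \<open>n\<close>.\<close>

lemma geodesic_seq_dist:
  assumes "geodesic_seq n p" "i \<le> j" "j \<le> n"
  shows "D (p i) (p j) = j - i"
proof (rule antisym)
  have le: "D (p i) (p j) \<le> j - i" if "i \<le> j" "j \<le> n" for i j
    using assms(1) that by (intro step_dist_le adj_relpow_segment) (auto simp: geodesic_seq_def)
  have V: "p i \<in> V" if "i \<le> n" for i using assms(1) that by (simp add: geodesic_seq_def)
  show "D (p i) (p j) \<le> j - i" using le assms by blast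
  have "n = D (p 0) (p n)" using assms(1) by (simp add: geodesic_seq_def)
  also have "\<dots> \<le> D (p 0) (p i) + (D (p i) (p j) + D (p j) (p n))"
    using D_triangle[of "p 0" "p i" "p n"] D_triangle[of "p i" "p j" "p n"] V assms by force
  also have "\<dots> \<le> i + (D (p i) (p j) + (n - j))"
    using le[of 0 i] le[of j n] assms by simp
  finally show "j - i \<le> D (p i) (p j)" using assms by simp
qed

lemma nat_plus_fraction_neq_nat:
  assumes "real i = real k + t" "0 < t" "t < 1" shows False
proof -
  have "real k < real i" "real i < real (Suc k)" using assms by auto
  then show False by (simp only: of_nat_less_iff)
qed

text \<open>At an integral time \<open>i\<close> the distance from \<open>a\<close> is the integer \<open>i\<close>, whereas the interior points of
  an edge have a non-integral distance from every vertex; so the curve is at a vertex \<open>p i\<close>. At time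
  \<open>i + t\<close> with \<open>0 < t < 1\<close> the curve is, for the same reason, in the interior of an edge; this point
  has distances \<open>t\<close> and \<open>1 - t\<close>, both less than \<open>1\<close>, from \<open>p i\<close> and \<open>p (i + 1)\<close>, which forces these
  vertices to be the endpoints of that edge.\<close>

lemma geodesic_curve_vertex_sequence:
  assumes V: "a \<in> V" "b \<in> V"
    and ends: "\<gamma> 0 = vertex_point a" "\<gamma> L = vertex_point b" and L: "0 \<le> L"
    and sub: "\<gamma> ` {0..L} \<subseteq> graph_points V E"
    and iso: "\<And>s t. s \<in> {0..L} \<Longrightarrow> t \<in> {0..L} \<Longrightarrow> graph_dist E (\<gamma> s) (\<gamma> t) = \<bar>s - t\<bar>"
  obtains n p where "L = real n" "geodesic_seq n p" "p 0 = a" "p n = b"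
    "\<And>i. i \<le> n \<Longrightarrow> \<gamma> (real i) = vertex_point (p i)"
    "\<And>i t. i < n \<Longrightarrow> t \<in> {0..1} \<Longrightarrow> \<gamma> (real i + t) = edge_point (p i) (p (Suc i)) t"
proof -
  define n where "n = D a b"
  have Ln: "L = real n"
    using iso[of 0 L] L graph_dist_vertices[OF V] by (simp add: ends n_def)
  have "\<exists>v. v \<in> V \<and> \<gamma> (real i) = vertex_point v" if i: "i \<le> n" for i
  proof -
    have "\<gamma> (real i) \<in> graph_points V E" using sub i Ln by auto
    with simple show ?thesis
    proof (cases rule: graph_points_cases)
      case (edge u v t)
      have "graph_dist E (vertex_point a) (\<gamma> (real i)) = real i"
        using iso[of 0 "real i"] i by (simp add: ends Ln)
      then have "real i = real (D a u) + t \<or> real i = real (D a v) + (1 - t)"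
        using edge V by (auto simp: graph_dist_vertex_edge min_def split: if_splits)
      then show ?thesis
        using nat_plus_fraction_neq_nat[of i "D a u" t] nat_plus_fraction_neq_nat[of i "D a v" "1 - t"] edge
        by auto
    qed auto
  qed
  then obtain p where p: "\<And>i. i \<le> n \<Longrightarrow> p i \<in> V" "\<And>i. i \<le> n \<Longrightarrow> \<gamma> (real i) = vertex_point (p i)"
    by metis
  have p0: "p 0 = a" "p n = b" using p(2)[of 0] p(2)[of n] ends Ln by auto
  have dist: "D (p i) (p (Suc i)) = 1" if "i < n" for i
  proof -
    have "real (D (p i) (p (Suc i))) = graph_dist E (\<gamma> (real i)) (\<gamma> (real (Suc i)))"
      using p that by (simp only: graph_dist_vertices Suc_leI less_imp_le)
    also have "\<dots> = \<bar>real i - real (Suc i)\<bar>" using that Ln by (intro iso) auto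
    finally show ?thesis by simp
  qed
  have edges: "{p i, p (Suc i)} \<in> E" if "i < n" for i
    using dist[OF that] p that by (intro adjacent_of_D_1) auto
  have seq: "geodesic_seq n p"
    using p edges p0 by (auto simp: geodesic_seq_def n_def)
  have "\<gamma> (real i + t) = edge_point (p i) (p (Suc i)) t" if i: "i < n" and t: "t \<in> {0..1}" for i t
  proof -
    have ne: "p i \<noteq> p (Suc i)" using edgeD[OF edges[OF i]] by simp
    consider "t = 0" | "t = 1" | "0 < t" "t < 1" using t by fastforce
    then show ?thesis
    proof cases
      case 1
      then show ?thesis using p i by simp
    next
      case 2
      then show ?thesis using p(2)[of "Suc i"] i ne by (simp add: edge_point_1 add.commute)
    next
      case 3
      have iL: "real i + t \<in> {0..L}" "real i \<in> {0..L}" "real (Suc i) \<in> {0..L}"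
        using i t Ln by auto
      have d: "graph_dist E (vertex_point (p i)) (\<gamma> (real i + t)) = t"
        "graph_dist E (vertex_point (p (Suc i))) (\<gamma> (real i + t)) = 1 - t"
        using iso[OF iL(2,1)] iso[OF iL(3,1)] p(2)[of i] p(2)[of "Suc i"] i 3 by auto
      have "\<gamma> (real i + t) \<in> graph_points V E" using sub iL by blast
      with simple show ?thesis
      proof (cases rule: graph_points_cases)
        case (vertex v)
        with d(1) have "real (D (p i) v) = real 0 + t"
          using p i by (simp add: graph_dist_vertices)
        from nat_plus_fraction_neq_nat[OF this 3] show ?thesis ..
      next
        case (edge u v s)
        have small: "k = 0 \<and> r = r'" if "real k + r = r'" "0 < r" "r' < 1" for k r r'
        proof -
          have "real k < 1" using that by simp
          then have "k = 0" by simp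
          with that show ?thesis by simp
        qed
        have min1: "min (real (D (p i) u) + s) (real (D (p i) v) + (1 - s)) = t"
          using d(1) edge p i by (simp add: graph_dist_vertex_edge add_diff_eq)
        have min2: "min (real (D (p (Suc i)) u) + s) (real (D (p (Suc i)) v) + (1 - s)) = 1 - t"
          using d(2) edge p(1)[of "Suc i"] i by (simp add: graph_dist_vertex_edge add_diff_eq)
        have z: "D (p i) w = 0 \<longleftrightarrow> p i = w" "D (p (Suc i)) w = 0 \<longleftrightarrow> p (Suc i) = w" if "w \<in> V" for w
          using D_0_iff p i that by auto
        have "(p i = u \<and> s = t) \<or> (p i = v \<and> 1 - s = t)"
          using min1 small[of "D (p i) u" s t] small[of "D (p i) v" "1 - s" t] edge 3 z edgeD[OF edge(1)]
          by (auto simp: min_def split: if_splits)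
        moreover have "(p (Suc i) = u \<and> s = 1 - t) \<or> (p (Suc i) = v \<and> 1 - s = 1 - t)"
          using min2 small[of "D (p (Suc i)) u" s "1 - t"] small[of "D (p (Suc i)) v" "1 - s" "1 - t"]
            edge 3 z edgeD[OF edge(1)]
          by (auto simp: min_def split: if_splits)
        ultimately consider "p i = u" "p (Suc i) = v" "s = t" | "p i = v" "p (Suc i) = u" "s = 1 - t"
          using ne by auto
        then show ?thesis
        proof cases
          case 1
          with edge show ?thesis by simp
        next
          case 2
          then show ?thesis unfolding edge(4) using ne edge_point_swap[of v u "1 - t"] by simp
        qed
      qed
    qed
  qed
  with that Ln seq p0 p(2) show thesis by blast
qed

end

section \<open>Walks and their subgraphs\<close>

lemma set_map_upt_Suc: "set (map p [0..<Suc n]) = p ` {..n}"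
  unfolding set_map set_upt by (simp add: atLeastLessThanSuc_atLeastAtMost atLeast0AtMost)

lemma walk_edges_map:
  "walk_edges (map p [r..<Suc s]) = {{p i, p (Suc i)} | i. r \<le> i \<and> i < s}"
proof -
  have nth: "map p [r..<Suc s] ! i = p (r + i)" if "i < Suc s - r" for i
    using that by (subst nth_map) (auto simp del: upt_Suc)
  show ?thesis (is "?L = ?R")
  proof
    show "?L \<subseteq> ?R"
    proof
      fix e assume "e \<in> ?L"
      then obtain i where i: "e = {map p [r..<Suc s] ! i, map p [r..<Suc s] ! Suc i}" "Suc i < Suc s - r"
        by (auto simp: walk_edges_def simp del: upt_Suc)
      with nth[of i] nth[of "Suc i"] have "e = {p (r + i), p (Suc (r + i))}" by simp
      with i show "e \<in> ?R" by (intro CollectI exI[of _ "r + i"]) auto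
    qed
    show "?R \<subseteq> ?L"
    proof
      fix e assume "e \<in> ?R"
      then obtain i where i: "e = {p i, p (Suc i)}" "r \<le> i" "i < s" by auto
      then have "e = {map p [r..<Suc s] ! (i - r), map p [r..<Suc s] ! Suc (i - r)}"
        using nth[of "i - r"] nth[of "Suc (i - r)"] by simp
      with i show "e \<in> ?L" unfolding walk_edges_def
        by (intro CollectI exI[of _ "i - r"]) (auto simp del: upt_Suc)
    qed
  qed
qed

lemma walk_edges_simps [simp]:
  "walk_edges [] = {}" "walk_edges [x] = {}"
  "walk_edges (x # y # zs) = insert {x, y} (walk_edges (y # zs))"
proof -
  show "walk_edges (x # y # zs) = insert {x, y} (walk_edges (y # zs))"
  proof -
    have "{{(x # y # zs) ! i, (x # y # zs) ! Suc i} | i. Suc i < length (x # y # zs)}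
      = (\<lambda>i. {(x # y # zs) ! i, (y # zs) ! i}) ` {..<Suc (length zs)}"
      by auto
    also have "\<dots> = insert {x, y} ((\<lambda>i. {(y # zs) ! i, zs ! i}) ` {..<length zs})"
      unfolding lessThan_Suc_eq_insert_0 by (auto simp: image_image)
    finally show ?thesis unfolding walk_edges_def by auto
  qed
qed (auto simp: walk_edges_def)

lemma walk_edges_append:
  "walk_edges (xs @ y # ys) = walk_edges (xs @ [y]) \<union> walk_edges (y # ys)"
proof (induction xs)
  case (Cons x xs)
  then show ?case by (cases xs) auto
qed simp

lemma walk_edges_rev: "walk_edges (rev xs) = walk_edges xs"
proof (induction xs)
  case (Cons x xs)
  show ?case
  proof (cases xs)
    case (Cons y ys)
    then show ?thesis
      using Cons.IH walk_edges_append[of "rev ys" y "[x]"] by (auto simp: insert_commute)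
  qed simp
qed simp

lemma walk_edges_nth: "Suc i < length p \<Longrightarrow> {p ! i, p ! Suc i} \<in> walk_edges p"
  by (auto simp: walk_edges_def)

lemma walk_edgesE:
  assumes "e \<in> walk_edges p"
  obtains i where "Suc i < length p" "e = {p ! i, p ! Suc i}"
  using assms by (auto simp: walk_edges_def)

lemma walk_relpow:
  assumes "i \<le> j" "j < length p"
  shows "(p ! i, p ! j) \<in> adj (walk_edges p) ^^ (j - i)"
  using assms by (intro adj_relpow_segment walk_edges_nth) auto

lemma conn_graph_walk:
  assumes "simple_graph V E" "is_walk V E p"
  shows "conn_graph (set p) (walk_edges p)"
proof
  show "simple_graph (set p) (walk_edges p)"
    using assms by (force simp: simple_graph_def is_walk_def elim: walk_edgesE)
  fix a b assume "a \<in> set p" "b \<in> set p"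
  then obtain i j where ij: "i < length p" "j < length p" "a = p ! i" "b = p ! j"
    by (metis in_set_conv_nth)
  then show "\<exists>n. (a, b) \<in> adj (walk_edges p) ^^ n"
    using walk_relpow[of i j p] adj_relpow_sym[OF walk_relpow[of j i p]]
    by (metis nat_le_linear)
qed

lemma adj_relpow_mono:
  assumes "E \<subseteq> E'" shows "(a, b) \<in> adj E ^^ n \<Longrightarrow> (a, b) \<in> adj E' ^^ n"
proof (induction n arbitrary: b)
  case (Suc n)
  then show ?case using assms by (force simp: adj_def)
qed auto

lemma conn_graph_connected_graph:
  assumes "connected_graph V E" shows "conn_graph V E"
proof
  show "simple_graph V E" using assms by (simp add: connected_graph_def)
  fix a b assume "a \<in> V" "b \<in> V"
  then obtain p where p: "is_path V E p" "hd p = a" "last p = b"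
    using assms by (auto simp: connected_graph_def)
  then have ne: "p \<noteq> []" and sub: "walk_edges p \<subseteq> E" by (auto simp: is_path_def is_walk_def)
  have "(a, b) \<in> adj (walk_edges p) ^^ walk_length p"
    using walk_relpow[of 0 "length p - 1" p] ne p
    by (simp add: hd_conv_nth last_conv_nth walk_length_def)
  then show "\<exists>n. (a, b) \<in> adj E ^^ n" using adj_relpow_mono[OF sub] by blast
qed

lemma graph_points_Un: "graph_points (A \<union> B) (E \<union> F) = graph_points A E \<union> graph_points B F"
  by (auto simp: graph_points_def)

lemma simple_graph_edgeE:
  assumes "simple_graph V E" "e \<in> E"
  obtains u v where "e = {u, v}" "u \<noteq> v"
  using assms unfolding simple_graph_def by (meson card_2_iff)

lemma graph_points_subset_iff:
  assumes "simple_graph V E" "simple_graph V' E'"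
  shows "graph_points V E \<subseteq> graph_points V' E' \<longleftrightarrow> V \<subseteq> V' \<and> E \<subseteq> E'"
proof
  assume sub: "graph_points V E \<subseteq> graph_points V' E'"
  have "e \<in> E'" if eE: "e \<in> E" for e
  proof -
    obtain u v where e: "e = {u, v}" "u \<noteq> v" using simple_graph_edgeE[OF assms(1) eE] by blast
    then show ?thesis
      using that sub edge_in_graph_points_iff[of _ _ "1/2" u v] assms by auto
  qed
  moreover have "v \<in> V'" if "v \<in> V" for v
    using sub that vertex_in_graph_points_iff[OF assms(1), of v]
      vertex_in_graph_points_iff[OF assms(2), of v] by blast
  ultimately show "V \<subseteq> V' \<and> E \<subseteq> E'" by blast
qed (unfold graph_points_def, blast)

lemma graph_points_Int:
  assumes "simple_graph V E" "simple_graph V' E'" "E \<inter> E' = {}"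
  shows "graph_points V E \<inter> graph_points V' E' = vertex_point ` (V \<inter> V')"
proof
  show "graph_points V E \<inter> graph_points V' E' \<subseteq> vertex_point ` (V \<inter> V')"
  proof
    fix x assume x: "x \<in> graph_points V E \<inter> graph_points V' E'"
    with assms(1) have "x \<in> graph_points V E" by blast
    with assms(1) show "x \<in> vertex_point ` (V \<inter> V')"
    proof (cases rule: graph_points_cases)
      case (vertex v)
      then show ?thesis using x vertex_in_graph_points_iff[OF assms(2)] by blast
    next
      case (edge u v t)
      then have "{u, v} \<in> E'"
        using x edge_in_graph_points_iff[OF assms(2) edge(2,3)] simple_graph_edgeD[OF assms(1) edge(1)]
        by blast
      with edge assms show ?thesis by blast
    qed
  qed
qed (auto simp: graph_points_def)

section \<open>Geodesics as unions of edges\<close>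

context conn_graph
begin

lemma geodesic_seq_inj:
  assumes "geodesic_seq n p" shows "inj_on p {..n}"
proof (rule linorder_inj_onI)
  fix i j assume "i < j" "i \<in> {..n}" "j \<in> {..n}"
  with geodesic_seq_dist[OF assms, of i j] show "p i \<noteq> p j" by auto
qed auto

text \<open>The index of a vertex on either sequence is its distance from the common starting vertex.\<close>

lemma geodesic_seq_common_index:
  assumes "geodesic_seq n p" "geodesic_seq n q" "p 0 = q 0" "i \<le> n" "j \<le> n" "p i = q j"
  shows "i = j"
  using geodesic_seq_dist[OF assms(1), of 0 i] geodesic_seq_dist[OF assms(2), of 0 j] assms by simp

lemma geodesic_seq_path:
  assumes "geodesic_seq n p" "r \<le> s" "s \<le> n"
  shows "is_path V E (map p [r..<Suc s])"
proof -
  have "inj_on p {r..<Suc s}"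
    using geodesic_seq_inj[OF assms(1)] by (rule inj_on_subset) (use assms in auto)
  moreover have "walk_edges (map p [r..<Suc s]) \<subseteq> E" "p ` {r..<Suc s} \<subseteq> V"
    unfolding walk_edges_map using assms by (auto simp: geodesic_seq_def)
  ultimately show ?thesis
    using assms(2) by (simp add: is_path_def is_walk_def distinct_map del: upt_Suc)
qed

lemma geodesic_curve_segment:
  assumes seq: "geodesic_seq n p"
    and vertex: "\<And>i. i \<le> n \<Longrightarrow> \<gamma> (real i) = vertex_point (p i)"
    and edge: "\<And>i t. i < n \<Longrightarrow> t \<in> {0..1} \<Longrightarrow> \<gamma> (real i + t) = edge_point (p i) (p (Suc i)) t"
    and rs: "r \<le> s" "s \<le> n"
  shows "\<gamma> ` {real r..real s} = walk_points (map p [r..<Suc s])"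
proof -
  have E: "{p i, p (Suc i)} \<in> E" if "i < n" for i using seq that by (simp add: geodesic_seq_def)
  have points: "walk_points (map p [r..<Suc s]) = vertex_point ` p ` {r..s} \<union>
    {edge_point u v t | u v t. (\<exists>i. {u, v} = {p i, p (Suc i)} \<and> r \<le> i \<and> i < s) \<and> t \<in> {0..1}}"
    unfolding walk_points_def graph_points_def walk_edges_map set_map set_upt
    by (simp add: atLeastLessThanSuc_atLeastAtMost)
  show ?thesis unfolding points
  proof (intro equalityI subsetI)
    fix x assume "x \<in> \<gamma> ` {real r..real s}"
    then obtain t where t: "x = \<gamma> t" "real r \<le> t" "t \<le> real s" by auto
    show "x \<in> vertex_point ` p ` {r..s} \<union>
      {edge_point u v t | u v t. (\<exists>i. {u, v} = {p i, p (Suc i)} \<and> r \<le> i \<and> i < s) \<and> t \<in> {0..1}}"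
    proof (cases "t = real s")
      case True
      then show ?thesis using t vertex[of s] rs by auto
    next
      case False
      define i where "i = nat \<lfloor>t\<rfloor>"
      have i: "real i \<le> t" "t < real i + 1" using t(2) unfolding i_def by linarith+
      have "r \<le> i" unfolding i_def using t(2) by (simp add: le_nat_floor)
      moreover have "real i < real s" using i t False by linarith
      then have "i < s" by simp
      moreover have "x = edge_point (p i) (p (Suc i)) (t - real i)"
        using edge[of i "t - real i"] i \<open>i < s\<close> rs t by simp
      moreover have "t - real i \<in> {0..1}" using i by auto
      ultimately show ?thesis by blast
    qed
  next
    fix x assume "x \<in> vertex_point ` p ` {r..s} \<union>
      {edge_point u v t | u v t. (\<exists>i. {u, v} = {p i, p (Suc i)} \<and> r \<le> i \<and> i < s) \<and> t \<in> {0..1}}"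
    then consider i where "r \<le> i" "i \<le> s" "x = vertex_point (p i)"
      | u v t i where "{u, v} = {p i, p (Suc i)}" "r \<le> i" "i < s" "t \<in> {0..1}" "x = edge_point u v t"
      by auto
    then show "x \<in> \<gamma> ` {real r..real s}"
    proof cases
      case 1
      then have "x = \<gamma> (real i)" using vertex rs by simp
      then show ?thesis using 1 by auto
    next
      case 2
      have "p i \<noteq> p (Suc i)" using edgeD(3)[OF E[of i]] 2 rs by simp
      then obtain t' where t': "t' \<in> {0..1}" "x = edge_point (p i) (p (Suc i)) t'"
        using 2 edge_point_swap[of "p i" "p (Suc i)" t] that[of t] that[of "1 - t"]
        by (auto simp: doubleton_eq_iff)
      then have "x = \<gamma> (real i + t')" using edge[of i t'] 2 rs by simp
      moreover have "real i + t' \<in> {real r..real s}" using 2 t' by auto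
      ultimately show ?thesis by blast
    qed
  qed
qed

text \<open>The last conclusion, that subsegments between vertices are geodesics as well, comes from
  restricting and shifting the given curve.\<close>

lemma geodesicE:
  assumes "is_geodesic V E (vertex_point a) (vertex_point b) S" "a \<in> V" "b \<in> V"
  obtains n p where "geodesic_seq n p" "p 0 = a" "p n = b" "S = walk_points (map p [0..<Suc n])"
    "\<And>r s. r \<le> s \<Longrightarrow> s \<le> n \<Longrightarrow>
       is_geodesic V E (vertex_point (p r)) (vertex_point (p s)) (walk_points (map p [r..<Suc s]))"
proof -
  obtain L \<gamma> where g: "0 \<le> L" "\<gamma> 0 = vertex_point a" "\<gamma> L = vertex_point b" "S = \<gamma> ` {0..L}"
    "S \<subseteq> graph_points V E"
    "\<And>s t. s \<in> {0..L} \<Longrightarrow> t \<in> {0..L} \<Longrightarrow> graph_dist E (\<gamma> s) (\<gamma> t) = \<bar>s - t\<bar>"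
    using assms(1) unfolding is_geodesic_def by blast
  obtain n p where p: "L = real n" "geodesic_seq n p" "p 0 = a" "p n = b"
    and vertex: "\<And>i. i \<le> n \<Longrightarrow> \<gamma> (real i) = vertex_point (p i)"
    and edge: "\<And>i t. i < n \<Longrightarrow> t \<in> {0..1} \<Longrightarrow> \<gamma> (real i + t) = edge_point (p i) (p (Suc i)) t"
    using geodesic_curve_vertex_sequence[OF assms(2,3) g(2,3,1) g(5)[unfolded g(4)] g(6)] by blast
  have seg: "\<gamma> ` {real r..real s} = walk_points (map p [r..<Suc s])" if "r \<le> s" "s \<le> n" for r s
    by (rule geodesic_curve_segment[OF p(2) _ _ that]) (auto intro: vertex edge)
  have "is_geodesic V E (vertex_point (p r)) (vertex_point (p s)) (walk_points (map p [r..<Suc s]))"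
    if rs: "r \<le> s" "s \<le> n" for r s
    unfolding is_geodesic_def
  proof (intro exI[of _ "real s - real r"] exI[of _ "\<lambda>t. \<gamma> (real r + t)"] conjI ballI)
    have "(\<lambda>t. \<gamma> (real r + t)) ` {0..real s - real r} = \<gamma> ` {real r..real s}"
      using image_add_atLeastAtMost[of "real r" 0 "real s - real r"] by (simp flip: image_image)
    then show "walk_points (map p [r..<Suc s]) = (\<lambda>t. \<gamma> (real r + t)) ` {0..real s - real r}"
      using seg[OF rs] by simp
    have "\<gamma> ` {real r..real s} \<subseteq> S" unfolding g(4) using rs p(1) by (intro image_mono) auto
    then show "walk_points (map p [r..<Suc s]) \<subseteq> graph_points V E" using seg[OF rs] g(5) by simp
    fix u t assume "u \<in> {0..real s - real r}" "t \<in> {0..real s - real r}"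
    then show "graph_dist E (\<gamma> (real r + u)) (\<gamma> (real r + t)) = \<bar>u - t\<bar>"
      using g(6)[of "real r + u" "real r + t"] rs p(1) by auto
  qed (use rs vertex in auto)
  moreover have "S = walk_points (map p [0..<Suc n])" using seg[of 0 n] g(4) p(1) by simp
  ultimately show thesis using that p by blast
qed

lemma geodesic_pairE:
  assumes S: "is_geodesic V E (vertex_point a) (vertex_point b) S"
    and T: "is_geodesic V E (vertex_point a) (vertex_point b) T" and ab: "a \<in> V" "b \<in> V"
  obtains n p q where "geodesic_seq n p" "geodesic_seq n q" "p 0 = a" "q 0 = a" "p n = b" "q n = b"
    "S = walk_points (map p [0..<Suc n])" "T = walk_points (map q [0..<Suc n])"
    "\<And>f r s. f \<in> {p, q} \<Longrightarrow> r \<le> s \<Longrightarrow> s \<le> n \<Longrightarrow>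
       is_geodesic V E (vertex_point (f r)) (vertex_point (f s)) (walk_points (map f [r..<Suc s]))"
proof -
  obtain n p where p: "geodesic_seq n p" "p 0 = a" "p n = b" "S = walk_points (map p [0..<Suc n])"
    and gp: "\<And>r s. r \<le> s \<Longrightarrow> s \<le> n \<Longrightarrow>
      is_geodesic V E (vertex_point (p r)) (vertex_point (p s)) (walk_points (map p [r..<Suc s]))"
    by (rule geodesicE[OF S ab]) (rule that)
  obtain n' q where q: "geodesic_seq n' q" "q 0 = a" "q n' = b" "T = walk_points (map q [0..<Suc n'])"
    and gq: "\<And>r s. r \<le> s \<Longrightarrow> s \<le> n' \<Longrightarrow>
      is_geodesic V E (vertex_point (q r)) (vertex_point (q s)) (walk_points (map q [r..<Suc s]))"
    by (rule geodesicE[OF T ab]) (rule that)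
  have n': "n' = n" using p(1-3) q(1-3) by (simp add: geodesic_seq_def)
  show thesis
  proof (rule that[OF p(1) q(1)[unfolded n'] p(2) q(2) p(3) q(3)[unfolded n'] p(4) q(4)[unfolded n']])
    fix f r s assume "f \<in> {p, q}" "r \<le> s" "s \<le> n"
    then show "is_geodesic V E (vertex_point (f r)) (vertex_point (f s)) (walk_points (map f [r..<Suc s]))"
      using gp[of r s] gq[of r s] n' by (auto simp del: upt_Suc)
  qed
qed

lemma shortest_path:
  assumes "a \<in> V" "b \<in> V"
  obtains w where "geodesic_seq (D a b) w" "w 0 = a" "w (D a b) = b"
proof -
  obtain w where w: "w 0 = a" "w (D a b) = b" "\<And>i. i < D a b \<Longrightarrow> {w i, w (Suc i)} \<in> E"
    using D_attained[OF assms] unfolding relpow_fun_conv by (auto simp: adj_def)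
  moreover have "w i \<in> V" if "i \<le> D a b" for i
    using that w edgeD(1) assms(2) by (metis le_neq_implies_less)
  ultimately show thesis using that[of w] by (simp add: geodesic_seq_def)
qed

lemma polygonal_exists:
  assumes "x \<in> graph_points V E" "y \<in> graph_points V E"
  shows "\<exists>l. polygonal E x y l"
proof -
  obtain u l where u: "u \<in> V" "polygonal E (vertex_point u) x l"
    using vertex_near_point[OF simple assms(1)] by blast
  obtain v m where v: "v \<in> V" "polygonal E (vertex_point v) y m"
    using vertex_near_point[OF simple assms(2)] by blast
  from polygonal_trans[OF polygonal_sym[OF u(2)] polygonal_trans[OF polygonal_vertices[OF u(1) v(1)] v(2)]]
  show ?thesis by blast
qed

lemma walk_step_dist:
  assumes "is_walk V E \<sigma>"
  shows "D (hd \<sigma>) (last \<sigma>) \<le> walk_length \<sigma>"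
proof -
  have ne: "\<sigma> \<noteq> []" and sub: "walk_edges \<sigma> \<subseteq> E" using assms by (auto simp: is_walk_def)
  have "(hd \<sigma>, last \<sigma>) \<in> adj (walk_edges \<sigma>) ^^ walk_length \<sigma>"
    using walk_relpow[of 0 "length \<sigma> - 1" \<sigma>] ne
    by (simp add: hd_conv_nth last_conv_nth walk_length_def)
  then show ?thesis by (rule step_dist_le[OF adj_relpow_mono[OF sub]])
qed

text \<open>A geodesic that runs inside a subgraph realises the distances of the whole graph there.\<close>

lemma geodesic_seq_subgraph_dist:
  assumes "geodesic_seq n p" "\<And>l. l < n \<Longrightarrow> r \<le> l \<Longrightarrow> l < s \<Longrightarrow> {p l, p (Suc l)} \<in> E'" "s \<le> n"
    and "i \<in> {r..s}" "j \<in> {r..s}"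
  shows "step_dist E' (p i) (p j) \<le> D (p i) (p j)"
proof -
  have *: "step_dist E' (p i) (p j) \<le> D (p i) (p j)" if "i \<le> j" "i \<in> {r..s}" "j \<in> {r..s}" for i j
  proof -
    have "(p i, p j) \<in> adj E' ^^ (j - i)"
      using that assms by (intro adj_relpow_segment) auto
    moreover have "D (p i) (p j) = j - i" using geodesic_seq_dist[OF assms(1)] that assms by auto
    ultimately show ?thesis using step_dist_le by metis
  qed
  show ?thesis
    using *[of i j] *[of j i] assms(4,5) by (metis nat_le_linear step_dist_commute)
qed

end

section \<open>Hausdorff distance bounds\<close>

lemma hausdorff_dist_leI:
  assumes "A \<noteq> {}" "B \<noteq> {}" "\<And>x y. x \<in> A \<Longrightarrow> y \<in> B \<Longrightarrow> 0 \<le> d x y"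
    and "\<And>x. x \<in> A \<Longrightarrow> \<exists>y\<in>B. d x y \<le> R" "\<And>y. y \<in> B \<Longrightarrow> \<exists>x\<in>A. d x y \<le> R"
  shows "hausdorff_dist d A B \<le> R"
proof -
  have "(SUP x\<in>A. INF y\<in>B. d x y) \<le> R"
  proof (rule cSUP_least[OF assms(1)])
    fix x assume x: "x \<in> A"
    then obtain y where "y \<in> B" "d x y \<le> R" using assms by blast
    with x show "(INF y\<in>B. d x y) \<le> R"
      by (intro cINF_lower2) (auto intro!: bdd_belowI[of _ 0] assms)
  qed
  moreover have "(SUP y\<in>B. INF x\<in>A. d x y) \<le> R"
  proof (rule cSUP_least[OF assms(2)])
    fix y assume y: "y \<in> B"
    then obtain x where "x \<in> A" "d x y \<le> R" using assms by blast
    with y show "(INF x\<in>A. d x y) \<le> R"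
      by (intro cINF_lower2) (auto intro!: bdd_belowI[of _ 0] assms)
  qed
  ultimately show ?thesis by (simp add: hausdorff_dist_def)
qed

text \<open>The uniform bound \<open>M\<close> makes the supremum in the Hausdorff distance meaningful; without it the
  supremum of an unbounded set of reals is an unspecified number.\<close>

lemma hausdorff_dist_leD:
  assumes "hausdorff_dist d A B \<le> R" "R < R'" "x \<in> A" "B \<noteq> {}"
    and "\<And>x y. x \<in> A \<Longrightarrow> y \<in> B \<Longrightarrow> 0 \<le> d x y"
    and "\<And>x. x \<in> A \<Longrightarrow> \<exists>y\<in>B. d x y \<le> M"
  shows "\<exists>y\<in>B. d x y < R'"
proof -
  have "bdd_above ((\<lambda>x. INF y\<in>B. d x y) ` A)"
  proof (rule bdd_aboveI2)
    fix x assume x: "x \<in> A"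
    then obtain y where "y \<in> B" "d x y \<le> M" using assms by blast
    with x show "(INF y\<in>B. d x y) \<le> M"
      by (intro cINF_lower2) (auto intro!: bdd_belowI[of _ 0] assms)
  qed
  then have "(INF y\<in>B. d x y) \<le> (SUP x\<in>A. INF y\<in>B. d x y)"
    using assms(3) by (intro cSUP_upper)
  also have "\<dots> \<le> R" using assms(1) by (simp add: hausdorff_dist_def)
  finally have "(INF y\<in>B. d x y) < R'" using assms(2) by simp
  then show ?thesis using cInf_lessD[of "d x ` B" R'] assms(4) by auto
qed

section \<open>Dense chordality implies stability\<close>

context conn_graph
begin

lemma subgraph_step_dist:
  assumes "conn_graph V' E'" "E' \<subseteq> E" "a \<in> V'" "b \<in> V'"
  shows "D a b \<le> step_dist E' a b"
  using conn_graph.D_attained[OF assms(1,3,4)] by (intro step_dist_le adj_relpow_mono[OF assms(2)])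

text \<open>Two geodesics with the same start, taken between consecutive common vertices, bound a cycle.
  The condition \<open>Suc r < s\<close> excludes the degenerate case of a single common edge.\<close>

lemma bigon_cycle:
  assumes p: "geodesic_seq n p" and q: "geodesic_seq n q" and start: "p 0 = q 0"
    and rs: "Suc r < s" "s \<le> n" and meet: "p r = q r" "p s = q s"
    and apart: "\<And>l. r < l \<Longrightarrow> l < s \<Longrightarrow> p l \<noteq> q l"
  obtains C where "is_cycle V E C" "set C = p ` {r..s} \<union> q ` {r..s}"
    "walk_edges C = walk_edges (map p [r..<Suc s]) \<union> walk_edges (map q [r..<Suc s])"
proof -
  define C where "C = map p [r..<s] @ rev (map q [r..<Suc s])"
  have rev: "rev (map q [r..<Suc s]) = q s # rev (map q [r..<s])" using rs by simp
  have setC: "set C = p ` {r..s} \<union> q ` {r..s}"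
  proof -
    have "{r..s} = insert s {r..<s}" using rs by auto
    moreover have "set C = p ` {r..<s} \<union> q ` {r..s}"
      unfolding C_def set_append set_rev set_map set_upt
      by (simp add: atLeastLessThanSuc_atLeastAtMost)
    ultimately show ?thesis using meet by auto
  qed
  have edgesC: "walk_edges C = walk_edges (map p [r..<Suc s]) \<union> walk_edges (map q [r..<Suc s])"
  proof -
    have "walk_edges C = walk_edges (map p [r..<s] @ [q s]) \<union> walk_edges (q s # rev (map q [r..<s]))"
      unfolding C_def rev by (rule walk_edges_append)
    also have "map p [r..<s] @ [q s] = map p [r..<Suc s]" using rs meet by simp
    finally show ?thesis unfolding rev[symmetric] walk_edges_rev .
  qed
  have upt: "[r..<s] = r # [Suc r..<s]" using rs by (simp add: upt_conv_Cons)
  have tl: "tl C = map p [Suc r..<s] @ rev (map q [r..<Suc s])" unfolding C_def upt by simp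
  have hd: "hd C = p r" unfolding C_def upt by simp
  have "last C = q r" unfolding C_def using rs by (simp add: last_rev hd_map upt del: upt_Suc)
  have path: "is_path V E (map p [r..<Suc s])" "is_path V E (map q [r..<Suc s])"
    using geodesic_seq_path p q rs by auto
  have "distinct (tl C)"
  proof -
    have "distinct (map p [Suc r..<s])"
      using geodesic_seq_inj[OF p] rs by (auto simp: distinct_map intro: inj_on_subset)
    moreover have "p l \<noteq> q l'" if "Suc r \<le> l" "l < s" "l' \<le> s" for l l'
      using geodesic_seq_common_index[OF p q start, of l l'] apart[of l] that rs by auto
    then have "p ` {Suc r..<s} \<inter> q ` {r..<Suc s} = {}" by force
    ultimately show ?thesis
      unfolding tl using path by (simp add: is_path_def del: upt_Suc)
  qed
  moreover have "is_walk V E C"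
    using path setC edgesC rs unfolding is_path_def is_walk_def set_map set_upt
    by (auto simp: atLeastLessThanSuc_atLeastAtMost)
  moreover have "3 \<le> walk_length C"
    unfolding walk_length_def C_def using rs by simp
  ultimately have "is_cycle V E C"
    using hd \<open>last C = q r\<close> meet by (simp add: is_cycle_def)
  with that setC edgesC show thesis by blast
qed

text \<open>Removing the repeated first vertex leaves a list without repetitions that still contains all
  vertices.\<close>

lemma cycle_length_eq_card:
  assumes "is_cycle V E C" shows "walk_length C = card (set C)"
proof -
  have "set C = set (tl C)"
    using assms unfolding is_cycle_def is_walk_def walk_length_def
    by (cases C) (auto simp: last_ConsR split: if_splits)
  then show ?thesis using assms by (simp add: is_cycle_def distinct_card walk_length_def)
qed

text \<open>The bigon used is the one between the last common vertex \<open>p r\<close> before \<open>p i\<close> and the first common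
  vertex \<open>p s\<close> after it.\<close>

lemma vertex_close_of_chordal:
  assumes chordal: "densely_chordal_on V E \<epsilon> k m (geodesic_bigon_cycles V E)"
    and p: "geodesic_seq n p" and q: "geodesic_seq n q" and ends: "p 0 = q 0" "p n = q n"
    and geod: "\<And>f r s. f \<in> {p, q} \<Longrightarrow> r \<le> s \<Longrightarrow> s \<le> n \<Longrightarrow>
       is_geodesic V E (vertex_point (f r)) (vertex_point (f s)) (walk_points (map f [r..<Suc s]))"
    and i: "i \<le> n"
  obtains j where "j \<le> n" "real (D (p i) (q j)) \<le> real k + \<bar>\<epsilon>\<bar> + real m"
proof (cases "p i = q i")
  case True
  then show thesis using that[of i] i by simp
next
  case False
  define r where "r = Max {l. l < i \<and> p l = q l}"
  define s where "s = Min {l. i < l \<and> l \<le> n \<and> p l = q l}"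
  have i0: "0 < i" "i < n" using False ends i by (metis neq0_conv, metis le_neq_implies_less)
  have "r \<in> {l. l < i \<and> p l = q l}" unfolding r_def using ends i0 by (intro Max_in) auto
  then have r: "r < i" "p r = q r" by auto
  have "s \<in> {l. i < l \<and> l \<le> n \<and> p l = q l}" unfolding s_def using ends i0 by (intro Min_in) auto
  then have s: "i < s" "s \<le> n" "p s = q s" by auto
  have apart: "p l \<noteq> q l" if "r < l" "l < s" for l
  proof
    assume eq: "p l = q l"
    then have "l \<noteq> i" using False by auto
    then consider "l < i" | "i < l" by linarith
    then show False
    proof cases
      case 1
      then have "l \<le> r" unfolding r_def using eq by (intro Max_ge) auto
      with that show False by simp
    next
      case 2
      then have "s \<le> l" unfolding s_def using eq that s by (intro Min_le) auto
      with that show False by simp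
    qed
  qed
  obtain C where C: "is_cycle V E C" "set C = p ` {r..s} \<union> q ` {r..s}"
    "walk_edges C = walk_edges (map p [r..<Suc s]) \<union> walk_edges (map q [r..<Suc s])"
    using bigon_cycle[OF p q ends(1) _ s(2) r(2) s(3) apart] r s by force
  have "walk_points C = walk_points (map p [r..<Suc s]) \<union> walk_points (map q [r..<Suc s])"
    unfolding walk_points_def C(2,3) set_map set_upt graph_points_Un atLeastLessThanSuc_atLeastAtMost ..
  moreover have "r \<le> n" using r s by simp
  then have "p r \<in> V" "p s \<in> V" using p s unfolding geodesic_seq_def by blast+
  ultimately have bigon: "C \<in> geodesic_bigon_cycles V E"
    unfolding geodesic_bigon_cycles_def
    using C(1) geod[of p r s] geod[of q r s] r s by (auto simp del: upt_Suc)
  show thesis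
  proof (cases "k \<le> walk_length C")
    case False
    have "D (p i) (q r) = i - r"
      using geodesic_seq_dist[OF p, of r i] r i by (simp add: step_dist_commute)
    moreover have "card (p ` {r..s}) = Suc s - r"
      using geodesic_seq_inj[OF p] s by (subst card_image) (auto intro: inj_on_subset)
    moreover have "card (p ` {r..s}) \<le> walk_length C"
      unfolding cycle_length_eq_card[OF C(1)] C(2) by (intro card_mono) auto
    ultimately have "D (p i) (q r) \<le> k" using False s by simp
    then show thesis using that[of r] r i by simp
  next
    case True
    from chordal[unfolded densely_chordal_on_def, rule_format, OF bigon this]
    obtain \<Sigma> where *: "finite \<Sigma> \<and> (\<forall>\<sigma>\<in>\<Sigma>. is_strict_shortcut V E C \<sigma> \<and> walk_length \<sigma> \<le> m) \<and>
      eps_dense \<epsilon> (graph_dist (walk_edges C)) (walk_points C)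
         (\<Union>\<sigma>\<in>\<Sigma>. {vertex_point (hd \<sigma>), vertex_point (last \<sigma>)})" ..
    note \<Sigma> = bspec[OF conjunct1[OF conjunct2[OF *]]] conjunct2[OF conjunct2[OF *]]
    have walk: "is_walk V E C" using C by (simp add: is_cycle_def)
    interpret C: conn_graph "set C" "walk_edges C" by (rule conn_graph_walk[OF simple walk])
    have sub: "walk_edges C \<subseteq> E" using walk by (simp add: is_walk_def)
    have CV: "set C \<subseteq> V" using walk by (simp add: is_walk_def)
    have pi: "p i \<in> set C" using C(2) r s by auto
    then have "vertex_point (p i) \<in> walk_points C" by (simp add: walk_points_def graph_points_def)
    then obtain \<sigma> e where \<sigma>: "\<sigma> \<in> \<Sigma>" "e \<in> {hd \<sigma>, last \<sigma>}"
      "graph_dist (walk_edges C) (vertex_point e) (vertex_point (p i)) < \<epsilon>"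
      using \<Sigma>(2) unfolding eps_dense_def by blast
    then have short: "is_path V E \<sigma>" "hd \<sigma> \<in> set C" "last \<sigma> \<in> set C" "walk_length \<sigma> \<le> m"
      "real (walk_length \<sigma>)
         < graph_dist (walk_edges C) (vertex_point (hd \<sigma>)) (vertex_point (last \<sigma>))"
      using \<Sigma>(1)[OF \<sigma>(1)] by (auto simp: is_strict_shortcut_def is_shortcut_def)
    have len: "D (hd \<sigma>) (last \<sigma>) \<le> walk_length \<sigma>"
      using walk_step_dist short by (simp add: is_path_def)
    \<comment> \<open>The side \<open>p\<close> runs inside the cycle, so the cycle distance of two of its vertices is their
      distance in the graph and admits no shortcut.\<close>
    have "\<not> (hd \<sigma> \<in> p ` {r..s} \<and> last \<sigma> \<in> p ` {r..s})"
    proof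
      assume "hd \<sigma> \<in> p ` {r..s} \<and> last \<sigma> \<in> p ` {r..s}"
      then obtain l l' where l: "l \<in> {r..s}" "l' \<in> {r..s}" "hd \<sigma> = p l" "last \<sigma> = p l'" by blast
      have "{p l, p (Suc l)} \<in> walk_edges C" if "r \<le> l" "l < s" for l
        unfolding C(3) walk_edges_map using that by blast
      then have "step_dist (walk_edges C) (hd \<sigma>) (last \<sigma>) \<le> D (hd \<sigma>) (last \<sigma>)"
        unfolding l(3,4) by (rule geodesic_seq_subgraph_dist[OF p _ s(2) l(1,2)])
      with short len show False by (simp add: C.graph_dist_vertices)
    qed
    then have "hd \<sigma> \<in> q ` {r..s} \<or> last \<sigma> \<in> q ` {r..s}"
      using short(2,3) unfolding C(2) by blast
    then obtain j where j: "j \<in> {r..s}" "q j \<in> {hd \<sigma>, last \<sigma>}" by auto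
    have e: "e \<in> set C" "q j \<in> set C" using \<sigma> short j by auto
    have "D e (q j) \<le> m"
      using j \<sigma> short len by (auto simp: step_dist_commute[of E "last \<sigma>" "hd \<sigma>"])
    moreover have "real (D e (p i)) < \<epsilon>"
      using \<sigma>(3) subgraph_step_dist[OF C.conn_graph_axioms sub e(1) pi]
      by (simp add: C.graph_dist_vertices e pi)
    moreover have "D (p i) (q j) \<le> D (p i) e + D e (q j)"
      using D_triangle pi e CV by blast
    ultimately have "real (D (p i) (q j)) \<le> \<epsilon> + real m"
      by (simp add: step_dist_commute[of E "p i" e])
    then show thesis using that[of j] j s by simp
  qed
qed

lemma graph_dist_points_nonneg:
  "x \<in> graph_points V E \<Longrightarrow> y \<in> graph_points V E \<Longrightarrow> 0 \<le> graph_dist E x y"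
  using polygonal_exists graph_dist_nonneg by blast

text \<open>An arbitrary point of a geodesic is within distance \<open>1\<close> of one of its vertices, which accounts for
  the summand \<open>1\<close> in the constant.\<close>

lemma stable_of_chordal:
  assumes chordal: "densely_chordal_on V E \<epsilon> k m (geodesic_bigon_cycles V E)"
  shows "vertex_geodesics_stable V E"
proof -
  define R where "R = real k + \<bar>\<epsilon>\<bar> + real m + 1"
  have close: "\<exists>y\<in>T. graph_dist E x y \<le> R"
    if ab: "a \<in> V" "b \<in> V" and S: "is_geodesic V E (vertex_point a) (vertex_point b) S"
      and T: "is_geodesic V E (vertex_point a) (vertex_point b) T" and x: "x \<in> S" for a b S T x
  proof -
    obtain n p q where pq: "geodesic_seq n p" "geodesic_seq n q" "p 0 = a" "q 0 = a" "p n = b" "q n = b"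
      "S = walk_points (map p [0..<Suc n])" "T = walk_points (map q [0..<Suc n])"
      and geod: "\<And>f r s. f \<in> {p, q} \<Longrightarrow> r \<le> s \<Longrightarrow> s \<le> n \<Longrightarrow>
        is_geodesic V E (vertex_point (f r)) (vertex_point (f s)) (walk_points (map f [r..<Suc s]))"
      by (rule geodesic_pairE[OF S T ab]) (rule that)
    have ends: "p 0 = q 0" "p n = q n" using pq by simp_all
    have walk: "is_walk V E (map p [0..<Suc n])"
      using geodesic_seq_path[OF pq(1)] by (simp add: is_path_def del: upt_Suc)
    have "x \<in> graph_points (set (map p [0..<Suc n])) (walk_edges (map p [0..<Suc n]))"
      using x pq(7) by (simp only: walk_points_def)
    then obtain u l where u: "u \<in> set (map p [0..<Suc n])"
      "polygonal (walk_edges (map p [0..<Suc n])) (vertex_point u) x l" "l \<le> 1"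
      using vertex_near_point conn_graph.simple[OF conn_graph_walk[OF simple walk]] by metis
    then obtain i where i: "i \<le> n" "u = p i" by (auto simp: set_map_upt_Suc simp del: upt_Suc set_map)
    have xu: "polygonal E x (vertex_point (p i)) l"
      using polygonal_mono[OF u(2)] walk polygonal_sym unfolding is_walk_def i(2) by blast
    obtain j where j: "j \<le> n" "real (D (p i) (q j)) \<le> real k + \<bar>\<epsilon>\<bar> + real m"
      using vertex_close_of_chordal[OF chordal pq(1,2) ends geod i(1)] by blast
    have "p i \<in> V" "q j \<in> V" using pq(1,2) i j by (auto simp: geodesic_seq_def)
    from polygonal_trans[OF xu polygonal_vertices[OF this]]
    have "graph_dist E x (vertex_point (q j)) \<le> R"
      using graph_dist_le j(2) u(3) unfolding R_def by fastforce
    moreover have "vertex_point (q j) \<in> T"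
      using j unfolding pq(8) walk_points_def graph_points_def set_map_upt_Suc by blast
    ultimately show ?thesis by blast
  qed
  show ?thesis unfolding vertex_geodesics_stable_def
  proof (intro exI[of _ R] conjI ballI allI impI)
    show "0 \<le> R" by (simp add: R_def)
    fix a b S T
    assume ab: "a \<in> V" "b \<in> V" and S: "is_geodesic V E (vertex_point a) (vertex_point b) S"
      and T: "is_geodesic V E (vertex_point a) (vertex_point b) T"
    have sub: "S \<subseteq> graph_points V E" "T \<subseteq> graph_points V E" "S \<noteq> {}" "T \<noteq> {}"
      using S T unfolding is_geodesic_def by auto
    show "hausdorff_dist (graph_dist E) T S \<le> R"
    proof (rule hausdorff_dist_leI)
      show "\<exists>y\<in>S. graph_dist E x y \<le> R" if "x \<in> T" for x
        using close[OF ab T S that] .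
      show "\<exists>x\<in>T. graph_dist E x y \<le> R" if "y \<in> S" for y
        using close[OF ab S T that] by (simp add: graph_dist_commute)
    qed (use sub graph_dist_points_nonneg in auto)
  qed
qed

end

section \<open>Strict shortcuts in a geodesic bigon\<close>

text \<open>The cycle \<open>C\<close> consists of two geodesic sides, given as vertex sequences, that have only their
  endpoints in common. The conditions are symmetric in \<open>p\<close> and \<open>q\<close>, so facts about one side
  transfer to the other.\<close>

locale bigon = conn_graph V E for V :: "'a set" and E :: "'a set set" +
  fixes C :: "'a list" and n :: nat and p q :: "nat \<Rightarrow> 'a"
  assumes side: "geodesic_seq n p" "geodesic_seq n q"
    and ends: "p 0 = q 0" "p n = q n"
    and walk: "is_walk V E C"
    and vertices: "set C = p ` {..n} \<union> q ` {..n}"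
    and edges: "walk_edges C = walk_edges (map p [0..<Suc n]) \<union> walk_edges (map q [0..<Suc n])"
    and apart: "0 < i \<Longrightarrow> i < n \<Longrightarrow> p i \<noteq> q i"

sublocale bigon \<subseteq> C: conn_graph "set C" "walk_edges C"
  by (rule conn_graph_walk[OF simple walk])

context bigon
begin

abbreviation cycle_dist where "cycle_dist \<equiv> step_dist (walk_edges C)"

lemma bigon_flip: "bigon V E C n q p"
proof
  show "q i \<noteq> p i" if "0 < i" "i < n" for i using apart[OF that] by simp
qed (use side ends walk vertices edges in auto)

lemma common_vertex: "i \<le> n \<Longrightarrow> j \<le> n \<Longrightarrow> p i = q j \<Longrightarrow> i = j \<and> (i = 0 \<or> i = n)"
  using geodesic_seq_common_index[OF side ends(1), of i j] apart[of i] by (metis le_neq_implies_less neq0_conv)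

lemma p_in_V: "i \<le> n \<Longrightarrow> p i \<in> V" and q_in_V: "i \<le> n \<Longrightarrow> q i \<in> V"
  using side by (auto simp: geodesic_seq_def)

lemma p_in_C: "i \<le> n \<Longrightarrow> p i \<in> set C" and q_in_C: "i \<le> n \<Longrightarrow> q i \<in> set C"
  using vertices by auto

lemma cycle_edge_in_E: "walk_edges C \<subseteq> E"
  using walk by (simp add: is_walk_def)

text \<open>Every edge of the cycle belongs to one side. Hence the first step of the walk that leaves the
  side \<open>p\<close>, or the end of the walk if there is no such step, is at a vertex of both sides, that is,
  at an endpoint of the bigon.\<close>

lemma crossing_walk:
  assumes "(x, y) \<in> adj (walk_edges C) ^^ l" "x \<in> p ` {..n}" "y \<in> q ` {..n}"
  shows "\<exists>c\<in>{p 0, p n}. D x c + D c y \<le> l"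
  using assms
proof (induction l arbitrary: x)
  case 0
  then have "x = y" by simp
  then have "x \<in> {p 0, p n}" using 0 common_vertex by fastforce
  then show ?case using \<open>x = y\<close> by auto
next
  case (Suc l)
  show ?case
  proof (cases "x \<in> q ` {..n}")
    case True
    then have "x \<in> {p 0, p n}" using Suc.prems common_vertex by fastforce
    moreover have "D x y \<le> Suc l"
      using Suc.prems(1) by (intro step_dist_le adj_relpow_mono[OF cycle_edge_in_E])
    ultimately show ?thesis by (intro bexI[of _ x]) auto
  next
    case False
    obtain z where z: "(x, z) \<in> adj (walk_edges C)" "(z, y) \<in> adj (walk_edges C) ^^ l"
      using Suc.prems(1) by (meson relpow_Suc_D2)
    have xz: "{x, z} \<in> walk_edges C" using z(1) by (simp add: adj_def)
    have "z \<in> p ` {..n}"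
    proof -
      have "{x, z} \<notin> walk_edges (map q [0..<Suc n])"
      proof
        assume "{x, z} \<in> walk_edges (map q [0..<Suc n])"
        then obtain i where "{x, z} = {q i, q (Suc i)}" "i < n" unfolding walk_edges_map by blast
        then have "x \<in> q ` {..n}" by (auto simp: doubleton_eq_iff)
        with False show False by simp
      qed
      with xz edges have "{x, z} \<in> walk_edges (map p [0..<Suc n])" by blast
      then obtain i where "{x, z} = {p i, p (Suc i)}" "i < n" unfolding walk_edges_map by blast
      then show ?thesis by (auto simp: doubleton_eq_iff)
    qed
    from Suc.IH[OF z(2) this Suc.prems(3)] obtain c where c: "c \<in> {p 0, p n}" "D z c + D c y \<le> l"
      by blast
    have xzE: "{x, z} \<in> E" using xz cycle_edge_in_E by blast
    have "c \<in> V" using c(1) p_in_V by auto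
    then have "D x c \<le> 1 + D z c" using D_triangle[of x z c] edgeD[OF xzE] D_edge[OF xzE] by simp
    with c show ?thesis by (intro bexI[of _ c]) auto
  qed
qed

lemma cycle_dist_ge:
  assumes "i \<le> n" "j \<le> n"
  shows "min (i + j) ((n - i) + (n - j)) \<le> cycle_dist (p i) (q j)"
proof -
  obtain c where c: "c \<in> {p 0, p n}" "D (p i) c + D c (q j) \<le> cycle_dist (p i) (q j)"
    using crossing_walk[OF C.D_attained[OF p_in_C q_in_C]] assms by blast
  have "D (p i) (p 0) = i" "D (p i) (p n) = n - i"
    using geodesic_seq_dist[OF side(1), of 0 i] geodesic_seq_dist[OF side(1), of i n] assms
    by (auto simp: step_dist_commute[of E "p i" "p 0"])
  moreover have "D (p 0) (q j) = j" "D (p n) (q j) = n - j"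
    using geodesic_seq_dist[OF side(2), of 0 j] geodesic_seq_dist[OF side(2), of j n] assms
    unfolding ends by (auto simp: step_dist_commute[of E "q n" "q j"])
  ultimately show ?thesis using c by auto
qed

lemma cycle_dist_side:
  assumes "i \<le> n" "j \<le> n"
  shows "cycle_dist (p i) (p j) \<le> D (p i) (p j)"
  using assms edges by (intro geodesic_seq_subgraph_dist[OF side(1), of 0 n]) (auto simp: walk_edges_map simp del: upt_Suc)

lemma dist_along_side: "i \<le> n \<Longrightarrow> j \<le> n \<Longrightarrow> int (D (p i) (p j)) = \<bar>int i - int j\<bar>"
  using geodesic_seq_dist[OF side(1), of i j] geodesic_seq_dist[OF side(1), of j i]
  by (cases "i \<le> j") (auto simp: step_dist_commute[of E "p i"])

text \<open>Among the pairs consisting of a vertex \<open>p i'\<close> and a vertex \<open>q j'\<close> for which the detour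
  from \<open>p i\<close> through \<open>p i'\<close> to \<open>q j'\<close> has length at most \<open>R\<close>, take one with minimal distance
  \<open>d\<close>, and a shortest path \<open>w\<close> joining it. An inner vertex of \<open>w\<close> on either side of the bigon could
  replace \<open>p i'\<close> or \<open>q j'\<close> and give an admissible pair at smaller distance, so \<open>w\<close> meets the cycle
  only in its ends. These ends stay at distance at least \<open>R\<close> from both endpoints of the bigon,
  so their distance in the cycle is at least \<open>2 R\<close>, which exceeds \<open>d\<close>.\<close>

lemma strict_shortcut_near:
  assumes R: "1 \<le> R" and i: "2 * R \<le> i" "i + 2 * R \<le> n"
    and near: "j \<le> n" "D (p i) (q j) \<le> R"
  obtains \<sigma> where "is_strict_shortcut V E C \<sigma>" "walk_length \<sigma> \<le> R" "cycle_dist (hd \<sigma>) (p i) \<le> R"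
proof -
  define P where "P d \<longleftrightarrow> (\<exists>i'\<le>n. \<exists>j'\<le>n. D (p i) (p i') + D (p i') (q j') \<le> R \<and> D (p i') (q j') = d)" for d
  define d where "d = (LEAST d. P d)"
  have "P (D (p i) (q j))" unfolding P_def using i near by (intro exI[of _ i] conjI exI[of _ j]) auto
  then have "P d" unfolding d_def by (rule LeastI)
  then obtain i' j' where ij: "i' \<le> n" "j' \<le> n" "D (p i) (p i') + D (p i') (q j') \<le> R"
    "D (p i') (q j') = d" unfolding P_def by blast
  have minimal: "d \<le> D (p i'') (q j'')"
    if "i'' \<le> n" "j'' \<le> n" "D (p i) (p i'') + D (p i'') (q j'') \<le> R" for i'' j''
    unfolding d_def by (rule Least_le) (use that in \<open>auto simp: P_def\<close>)
  have i': "R \<le> i'" "R \<le> n - i'"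
    using dist_along_side[of i i'] ij i by auto
  have j': "R \<le> j'" "R \<le> n - j'"
  proof -
    have le: "D (p i) (q j') \<le> R"
      using D_triangle[of "p i" "p i'" "q j'"] p_in_V q_in_V ij i by force
    have "i \<le> D (p i) (q j') + j'"
      using D_triangle[of "p 0" "q j'" "p i"] geodesic_seq_dist[OF side(1), of 0 i]
        geodesic_seq_dist[OF side(2), of 0 j'] p_in_V q_in_V ij i ends
      by (simp add: step_dist_commute[of E "q j'"])
    with le i show "R \<le> j'" by simp
    have "n - i \<le> D (p i) (q j') + (n - j')"
      using D_triangle[of "p i" "q j'" "p n"] geodesic_seq_dist[OF side(1), of i n]
        geodesic_seq_dist[OF side(2), of j' n] p_in_V q_in_V ij i ends by simp
    with le i show "R \<le> n - j'" by simp
  qed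
  have long: "2 * R \<le> cycle_dist (p i') (q j')"
    using cycle_dist_ge[OF ij(1,2)] i' j' by simp
  have V: "p i' \<in> V" "q j' \<in> V" using p_in_V q_in_V ij by auto
  obtain w where w: "geodesic_seq d w" "w 0 = p i'" "w d = q j'"
    using shortest_path[OF V] ij(4) by auto
  define \<sigma> where "\<sigma> = map w [0..<Suc d]"
  have path: "is_path V E \<sigma>" unfolding \<sigma>_def using w by (intro geodesic_seq_path) auto
  have hl: "hd \<sigma> = p i'" "last \<sigma> = q j'"
    unfolding \<sigma>_def using w by (simp_all add: hd_map last_map hd_upt last_upt del: upt_Suc)
  have len: "walk_length \<sigma> = d" by (simp add: \<sigma>_def walk_length_def)
  have dR: "d \<le> R" using ij by simp
  have set\<sigma>: "set \<sigma> = w ` {..d}" unfolding \<sigma>_def set_map_upt_Suc ..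
  have inner: "l = 0 \<or> l = d" if l: "l \<le> d" "w l \<in> set C" for l
  proof (rule ccontr)
    assume *: "\<not> (l = 0 \<or> l = d)"
    have dl: "D (p i') (w l) = l" "D (w l) (q j') = d - l"
      using geodesic_seq_dist[OF w(1), of 0 l] geodesic_seq_dist[OF w(1), of l d] l w by auto
    from l(2) vertices consider i'' where "i'' \<le> n" "w l = p i''" | j'' where "j'' \<le> n" "w l = q j''"
      by auto
    then show False
    proof cases
      case 1
      have "D (p i) (p i'') \<le> D (p i) (p i') + l"
        using D_triangle[of "p i" "p i'" "p i''"] p_in_V 1 ij i dl by force
      then have "D (p i) (p i'') + D (p i'') (q j') \<le> R" using dl 1 ij l by simp
      from minimal[OF 1(1) ij(2) this] show False using dl 1 * l by auto
    next
      case 2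
      then have "D (p i) (p i') + D (p i') (q j'') \<le> R" using dl ij l by simp
      from minimal[OF ij(1) 2(1) this] show False using dl 2 * l by auto
    qed
  qed
  have common: "set \<sigma> \<inter> set C = {p i', q j'}"
  proof
    show "set \<sigma> \<inter> set C \<subseteq> {p i', q j'}" using inner w unfolding set\<sigma> by auto
    show "{p i', q j'} \<subseteq> set \<sigma> \<inter> set C"
      unfolding set\<sigma> using w p_in_C q_in_C ij by (auto intro: image_eqI[of _ w 0] image_eqI[of _ w d])
  qed
  \<comment> \<open>A common edge would join the two ends, which are far apart in the cycle.\<close>
  have no_edge: "walk_edges \<sigma> \<inter> walk_edges C = {}"
  proof (rule ccontr)
    assume "walk_edges \<sigma> \<inter> walk_edges C \<noteq> {}"
    then obtain l where l: "l < d" "{w l, w (Suc l)} \<in> walk_edges C"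
      unfolding \<sigma>_def walk_edges_map by blast
    then have "l = 0" "Suc l = d" using inner[of l] inner[of "Suc l"] C.edgeD[OF l(2)] by auto
    with w l have "{p i', q j'} \<in> walk_edges C" by auto
    then have "cycle_dist (p i') (q j') = 1" by (rule C.D_edge)
    with long R show False by simp
  qed
  have "walk_points \<sigma> \<inter> walk_points C = vertex_point ` {p i', q j'}"
    using graph_points_Int[OF conn_graph.simple[OF conn_graph_walk[OF simple, of \<sigma>]] C.simple no_edge] path
    unfolding common walk_points_def by (simp add: is_path_def)
  moreover have "is_shortcut V E C \<sigma>"
    unfolding is_shortcut_def hl len using path long dR R p_in_C q_in_C ij
    by (auto simp: C.graph_dist_vertices)
  ultimately have "is_strict_shortcut V E C \<sigma>" by (simp add: is_strict_shortcut_def hl)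
  moreover have "cycle_dist (hd \<sigma>) (p i) \<le> R"
    using cycle_dist_side[of i' i] ij i unfolding hl by (simp add: step_dist_commute[of _ "p i'"])
  ultimately show thesis using that len dR by simp
qed

text \<open>The index \<open>l\<close> is moved by at most \<open>2 R\<close> into the range \<open>{2 R..n - 2 R}\<close>, where shortcuts exist.\<close>

lemma strict_shortcut_near_side:
  assumes R: "1 \<le> R" and n: "4 * R \<le> n"
    and near: "\<And>i. i \<le> n \<Longrightarrow> \<exists>j\<le>n. D (p i) (q j) \<le> R" and l: "l \<le> n"
  shows "\<exists>\<sigma>. is_strict_shortcut V E C \<sigma> \<and> walk_length \<sigma> \<le> R \<and> cycle_dist (hd \<sigma>) (p l) \<le> 3 * R"
proof -
  define i where "i = min (max l (2 * R)) (n - 2 * R)"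
  have i: "2 * R \<le> i" "i + 2 * R \<le> n" "i \<le> n" using n by (auto simp: i_def)
  obtain \<sigma> where \<sigma>: "is_strict_shortcut V E C \<sigma>" "walk_length \<sigma> \<le> R" "cycle_dist (hd \<sigma>) (p i) \<le> R"
    using near[OF i(3)] strict_shortcut_near[OF R i(1,2)] by blast
  have "int (D (p i) (p l)) \<le> 2 * int R"
    using n l i(3) by (subst dist_along_side) (auto simp: i_def min_def max_def)
  then have "cycle_dist (p i) (p l) \<le> 2 * R" using cycle_dist_side[OF i(3) l] by simp
  moreover have "hd \<sigma> \<in> set C" using \<sigma>(1) by (simp add: is_strict_shortcut_def is_shortcut_def)
  ultimately have "cycle_dist (hd \<sigma>) (p l) \<le> 3 * R"
    using C.D_triangle[of "hd \<sigma>" "p i" "p l"] \<sigma>(3) p_in_C i(3) l by force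
  with \<sigma> show ?thesis by blast
qed

text \<open>One shortcut is chosen for each of the finitely many vertices of the cycle. An arbitrary point of
  the cycle is within \<open>1\<close> of a vertex, and the strict inequality in the definition of density is
  met by \<open>3 R + 2\<close>.\<close>

lemma dense_shortcuts:
  assumes R: "1 \<le> R" and n: "4 * R \<le> n"
    and near: "\<And>i. i \<le> n \<Longrightarrow> \<exists>j\<le>n. D (p i) (q j) \<le> R" "\<And>i. i \<le> n \<Longrightarrow> \<exists>j\<le>n. D (q i) (p j) \<le> R"
  shows "\<exists>\<Sigma>. finite \<Sigma> \<and> (\<forall>\<sigma>\<in>\<Sigma>. is_strict_shortcut V E C \<sigma> \<and> walk_length \<sigma> \<le> R) \<and>
     eps_dense (real (3 * R + 2)) (graph_dist (walk_edges C)) (walk_points C)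
       (\<Union>\<sigma>\<in>\<Sigma>. {vertex_point (hd \<sigma>), vertex_point (last \<sigma>)})"
proof -
  have "\<exists>\<sigma>. is_strict_shortcut V E C \<sigma> \<and> walk_length \<sigma> \<le> R \<and> cycle_dist (hd \<sigma>) z \<le> 3 * R"
    if "z \<in> set C" for z
    using that strict_shortcut_near_side[OF R n near(1)]
      bigon.strict_shortcut_near_side[OF bigon_flip R n near(2)]
    unfolding vertices by auto
  then obtain f where f: "is_strict_shortcut V E C (f z)" "walk_length (f z) \<le> R"
    "cycle_dist (hd (f z)) z \<le> 3 * R" if "z \<in> set C" for z
    by metis
  have "eps_dense (real (3 * R + 2)) (graph_dist (walk_edges C)) (walk_points C)
     (\<Union>\<sigma>\<in>f ` set C. {vertex_point (hd \<sigma>), vertex_point (last \<sigma>)})"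
    unfolding eps_dense_def
  proof (intro conjI ballI)
    show "(\<Union>\<sigma>\<in>f ` set C. {vertex_point (hd \<sigma>), vertex_point (last \<sigma>)}) \<subseteq> walk_points C"
      using f(1) by (auto simp: is_strict_shortcut_def is_shortcut_def walk_points_def graph_points_def)
    fix x assume "x \<in> walk_points C"
    then obtain z l where z: "z \<in> set C" "polygonal (walk_edges C) (vertex_point z) x l" "l \<le> 1"
      using vertex_near_point[OF C.simple] unfolding walk_points_def by blast
    have hd: "hd (f z) \<in> set C" using f(1)[OF z(1)] by (simp add: is_strict_shortcut_def is_shortcut_def)
    have "graph_dist (walk_edges C) (vertex_point (hd (f z))) x \<le> real (cycle_dist (hd (f z)) z) + l"
      by (intro graph_dist_le polygonal_trans[OF C.polygonal_vertices[OF hd z(1)] z(2)])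
    also have "\<dots> < real (3 * R + 2)" using f(3)[OF z(1)] z(3) by linarith
    finally show "\<exists>a\<in>\<Union>\<sigma>\<in>f ` set C. {vertex_point (hd \<sigma>), vertex_point (last \<sigma>)}.
        graph_dist (walk_edges C) a x < real (3 * R + 2)"
      using z(1) by blast
  qed
  with f show ?thesis by (intro exI[of _ "f ` set C"]) auto
qed

end

section \<open>Stability implies dense chordality\<close>

text \<open>A discrete intermediate value theorem on a circle: the two arcs between a position below
  level \<open>l\<close> and a position above it both contain a position at level \<open>l\<close>. The pair \<open>(0, L)\<close> is
  excluded because these two indices are the same position of the circle.\<close>

lemma cyclic_sequence_hits_level_twice:
  fixes f :: "nat \<Rightarrow> int"
  assumes "\<And>j. j < L \<Longrightarrow> \<bar>f (Suc j) - f j\<bar> \<le> 1" "f L = f 0"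
    and "\<alpha> \<le> L" "\<beta> \<le> L" "f \<alpha> < l" "l < f \<beta>"
  shows "\<exists>i j. i < j \<and> j \<le> L \<and> f i = l \<and> f j = l \<and> (i \<noteq> 0 \<or> j \<noteq> L)"
proof -
  have main: "\<exists>i j. i < j \<and> j \<le> L \<and> f i = l \<and> f j = l \<and> (i \<noteq> 0 \<or> j \<noteq> L)"
    if step: "\<And>j. j < L \<Longrightarrow> \<bar>f (Suc j) - f j\<bar> \<le> 1" and close: "f L = f 0"
      and ab: "\<alpha> < \<beta>" "\<beta> \<le> L" "f \<alpha> < l" "l < f \<beta>" for f :: "nat \<Rightarrow> int" and \<alpha> \<beta> l
  proof -
    have up: "\<exists>i\<ge>x. i \<le> y \<and> f i = l" if "x \<le> y" "y \<le> L" "f x \<le> l" "l \<le> f y" for x y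
      using nat_intermed_int_val[of x y f l] that step by force
    have down: "\<exists>i\<ge>x. i \<le> y \<and> f i = l" if "x \<le> y" "y \<le> L" "l \<le> f x" "f y \<le> l" for x y
    proof -
      have "\<bar>- f (Suc i) - - f i\<bar> \<le> 1" if "i < y" for i
        using step[of i] that \<open>y \<le> L\<close> by simp
      then show ?thesis using nat_intermed_int_val[of x y "\<lambda>i. - f i" "- l"] that by force
    qed
    obtain i where i: "\<alpha> \<le> i" "i \<le> \<beta>" "f i = l" using up[of \<alpha> \<beta>] ab by auto
    with ab have ne: "i \<noteq> \<alpha>" "i \<noteq> \<beta>" by auto
    show ?thesis
    proof (cases "f 0 \<le> l")
      case True
      then obtain j where j: "\<beta> \<le> j" "j \<le> L" "f j = l" using down[of \<beta> L] ab close by auto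
      with i ne ab have "i < j" "i \<noteq> 0" by auto
      with i j show ?thesis by blast
    next
      case False
      then obtain j where j: "j \<le> \<alpha>" "f j = l" using down[of 0 \<alpha>] ab by auto
      with i ne ab have "j < i" "i \<noteq> L" "i \<le> L" by auto
      with i j show ?thesis by blast
    qed
  qed
  have "\<alpha> \<noteq> \<beta>" using assms by auto
  then consider "\<alpha> < \<beta>" | "\<beta> < \<alpha>" by linarith
  then show ?thesis
  proof cases
    case 1
    then show ?thesis using main[of f \<alpha> \<beta> l] assms by blast
  next
    case 2
    have "\<bar>- f (Suc j) - - f j\<bar> \<le> 1" if "j < L" for j using assms(1)[OF that] by simp
    then show ?thesis using main[of "\<lambda>i. - f i" \<beta> \<alpha> "- l"] assms 2 by simp
  qed
qed

context conn_graph
begin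

lemma cycle_nth_eqD:
  assumes "is_cycle V E C" "i < j" "j \<le> walk_length C" "C ! i = C ! j"
  shows "i = 0 \<and> j = walk_length C"
proof -
  have C: "C \<noteq> []" "distinct (tl C)" "hd C = last C"
    using assms(1) by (auto simp: is_cycle_def is_walk_def)
  have inj: "i = j" if "0 < i" "0 < j" "i \<le> walk_length C" "j \<le> walk_length C" "C ! i = C ! j" for i j
  proof -
    obtain i' j' where ij: "i = Suc i'" "j = Suc j'" using \<open>0 < i\<close> \<open>0 < j\<close> gr0_implies_Suc by blast
    then have "tl C ! i' = tl C ! j'" "i' < length (tl C)" "j' < length (tl C)"
      using that by (auto simp: nth_tl walk_length_def)
    with C(2) ij show ?thesis by (simp add: nth_eq_iff_index_eq)
  qed
  have "C ! 0 = C ! walk_length C" using C by (simp add: hd_conv_nth last_conv_nth walk_length_def)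
  then show ?thesis using inj[of i j] inj[of "walk_length C" j] assms(2-4) by (cases "i = 0") auto
qed

text \<open>The distance from \<open>a\<close> changes by at most \<open>1\<close> along each edge, so it is a sequence to which the
  intermediate value theorem on the circle applies.\<close>

lemma cycle_level_not_single:
  assumes C: "is_cycle V E C" and ab: "a \<in> set C" "b \<in> set C"
    and level: "0 < l" "l < D a b"
  shows "\<exists>u\<in>set C. \<exists>v\<in>set C. u \<noteq> v \<and> D a u = l \<and> D a v = l"
proof -
  have ne: "C \<noteq> []" and V: "set C \<subseteq> V" and sub: "walk_edges C \<subseteq> E" and closed: "hd C = last C"
    using C by (auto simp: is_cycle_def is_walk_def)
  have len: "length C = Suc (walk_length C)" using ne by (simp add: walk_length_def)
  obtain \<alpha> \<beta> where idx: "\<alpha> \<le> walk_length C" "C ! \<alpha> = a" "\<beta> \<le> walk_length C" "C ! \<beta> = b"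
    using ab len by (metis in_set_conv_nth less_Suc_eq_le)
  define f where "f i = int (D a (C ! i))" for i
  have "\<bar>f (Suc j) - f j\<bar> \<le> 1" if "j < walk_length C" for j
  proof -
    have "{C ! j, C ! Suc j} \<in> E" using walk_edges_nth[of j C] that len sub by auto
    from D_edge_le[OF _ this, of a] show ?thesis using ab V unfolding f_def by force
  qed
  moreover have "f (walk_length C) = f 0"
    using ne closed by (simp add: f_def hd_conv_nth last_conv_nth walk_length_def)
  ultimately obtain i j where ij: "i < j" "j \<le> walk_length C" "f i = int l" "f j = int l"
    "i \<noteq> 0 \<or> j \<noteq> walk_length C"
    using cyclic_sequence_hits_level_twice[of "walk_length C" f \<alpha> \<beta> "int l"] idx level
    by (auto simp: f_def)
  then have "C ! i \<noteq> C ! j" using cycle_nth_eqD[OF C ij(1,2)] by auto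
  moreover have "C ! i \<in> set C" "C ! j \<in> set C" using ij len by auto
  ultimately show ?thesis using ij by (auto simp: f_def)
qed

text \<open>The equality of point sets determines the vertices and the edges of the cycle. A common inner
  vertex \<open>p i = q i\<close> would be the only vertex of the cycle at distance \<open>i\<close> from \<open>p 0\<close>, which is
  impossible in a cycle. The bound on the length counts the vertices of the two sides.\<close>

lemma bigon_of_cycle:
  assumes "C \<in> geodesic_bigon_cycles V E"
  obtains n p q where "bigon V E C n p q" "walk_length C \<le> 2 * n"
    "is_geodesic V E (vertex_point (p 0)) (vertex_point (p n)) (walk_points (map p [0..<Suc n]))"
    "is_geodesic V E (vertex_point (p 0)) (vertex_point (p n)) (walk_points (map q [0..<Suc n]))"
proof -
  obtain a b S T where C: "is_cycle V E C" and ab: "a \<in> V" "b \<in> V"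
    and S: "is_geodesic V E (vertex_point a) (vertex_point b) S"
    and T: "is_geodesic V E (vertex_point a) (vertex_point b) T"
    and points: "walk_points C = S \<union> T"
    using assms unfolding geodesic_bigon_cycles_def by blast
  obtain n p q where pq: "geodesic_seq n p" "geodesic_seq n q" "p 0 = a" "q 0 = a" "p n = b" "q n = b"
    and ST: "S = walk_points (map p [0..<Suc n])" "T = walk_points (map q [0..<Suc n])"
    by (rule geodesic_pairE[OF S T ab]) (rule that)
  have seqs: "geodesic_seq n p" "geodesic_seq n q" "p 0 = q 0" "p n = q n" using pq by simp_all
  define P Q where "P = map p [0..<Suc n]" and "Q = map q [0..<Suc n]"
  have walk: "is_walk V E C" "is_walk V E P" "is_walk V E Q"
    using C geodesic_seq_path[of n p 0 n] geodesic_seq_path[of n q 0 n] seqs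
    unfolding P_def Q_def by (auto simp: is_cycle_def is_path_def simp del: upt_Suc)
  note simp_walk = conn_graph.simple[OF conn_graph_walk[OF simple]]
  have PQ: "simple_graph (set P \<union> set Q) (walk_edges P \<union> walk_edges Q)"
    using simp_walk[OF walk(2)] simp_walk[OF walk(3)] unfolding simple_graph_def by blast
  have "graph_points (set C) (walk_edges C) = graph_points (set P \<union> set Q) (walk_edges P \<union> walk_edges Q)"
    using points unfolding ST graph_points_Un P_def Q_def by (simp only: walk_points_def)
  then have VE: "set C = set P \<union> set Q" "walk_edges C = walk_edges P \<union> walk_edges Q"
    using graph_points_subset_iff[OF PQ simp_walk[OF walk(1)]]
      graph_points_subset_iff[OF simp_walk[OF walk(1)] PQ] by auto
  have vertices: "set C = p ` {..n} \<union> q ` {..n}"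
    unfolding VE(1) P_def Q_def set_map_upt_Suc ..
  have level: "D (p 0) (p i) = i" "D (p 0) (q i) = i" if "i \<le> n" for i
    using geodesic_seq_dist[OF seqs(1), of 0 i] geodesic_seq_dist[OF seqs(2), of 0 i] that seqs(3) by auto
  have apart: "p i \<noteq> q i" if i: "0 < i" "i < n" for i
  proof
    assume eq: "p i = q i"
    have "p 0 \<in> set C" "p n \<in> set C" "i < D (p 0) (p n)" using i level[of n] vertices by auto
    from cycle_level_not_single[OF C this(1,2) i(1) this(3)]
    obtain u v where uv: "u \<in> set C" "v \<in> set C" "u \<noteq> v" "D (p 0) u = i" "D (p 0) v = i" by blast
    have "w = p i" if "w \<in> set C" "D (p 0) w = i" for w
      using that level eq unfolding vertices by auto
    with uv show False by metis
  qed
  have "bigon V E C n p q"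
    by unfold_locales (use seqs walk vertices VE(2) apart in \<open>auto simp: P_def Q_def\<close>)
  moreover have "walk_length C \<le> 2 * n"
  proof -
    have "q j \<in> p ` {..n} \<union> q ` {0<..<n}" if "j \<le> n" for j
      using that seqs(3,4)[symmetric] by (cases "j = 0 \<or> j = n") auto
    then have "set C \<subseteq> p ` {..n} \<union> q ` {0<..<n}" unfolding vertices by auto
    then have "card (set C) \<le> card (p ` {..n} \<union> q ` {0<..<n})" by (intro card_mono) auto
    also have "\<dots> \<le> card (p ` {..n}) + card (q ` {0<..<n})" by (rule card_Un_le)
    also have "\<dots> \<le> Suc n + (n - 1)"
      using card_image_le[of "{..n}" p] card_image_le[of "{0<..<n}" q] by simp
    finally have "card (set C) \<le> Suc n + (n - 1)" .
    moreover have "3 \<le> card (set C)"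
      using C cycle_length_eq_card[OF C] by (simp add: is_cycle_def)
    ultimately show ?thesis using cycle_length_eq_card[OF C] by linarith
  qed
  ultimately show thesis
    using that[of n p q] S T ST pq by (simp del: upt_Suc)
qed

lemma geodesic_bounded:
  assumes "is_geodesic V E x y S"
  obtains M where "x \<in> S" "\<And>z. z \<in> S \<Longrightarrow> graph_dist E z x \<le> M"
proof -
  obtain L \<gamma> where "0 \<le> L" "\<gamma> 0 = x" "S = \<gamma> ` {0..L}"
    "\<And>s t. s \<in> {0..L} \<Longrightarrow> t \<in> {0..L} \<Longrightarrow> graph_dist E (\<gamma> s) (\<gamma> t) = \<bar>s - t\<bar>"
    using assms unfolding is_geodesic_def by blast
  then show thesis using that[of L] by force
qed

text \<open>A bound on the Hausdorff distance gives a point of the second geodesic at distance less than \<open>R\<close>;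
  the nearer endpoint of its edge is a vertex at no larger distance.\<close>

lemma near_vertex_of_hausdorff:
  assumes S: "is_geodesic V E x y S" and T: "is_geodesic V E x y (walk_points (map q [0..<Suc n]))"
    and q: "geodesic_seq n q" and H: "hausdorff_dist (graph_dist E) S (walk_points (map q [0..<Suc n])) \<le> R0"
    and R: "R0 < real R" and u: "u \<in> V" "vertex_point u \<in> S"
  shows "\<exists>j\<le>n. D u (q j) \<le> R"
proof -
  let ?T = "walk_points (map q [0..<Suc n])"
  have sub: "S \<subseteq> graph_points V E" "?T \<subseteq> graph_points V E"
    using S T unfolding is_geodesic_def by blast+
  obtain M where M: "\<And>z. z \<in> S \<Longrightarrow> graph_dist E z x \<le> M" using geodesic_bounded[OF S] by blast
  have xT: "x \<in> ?T" using geodesic_bounded[OF T] by blast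
  have nonneg: "0 \<le> graph_dist E v w" if "v \<in> S" "w \<in> ?T" for v w
    using graph_dist_points_nonneg sub that by blast
  have "?T \<noteq> {}" "\<And>z. z \<in> S \<Longrightarrow> \<exists>w\<in>?T. graph_dist E z w \<le> M" using M xT by blast+
  from hausdorff_dist_leD[OF H R u(2) this(1) nonneg this(2)]
  obtain z where z: "z \<in> ?T" "graph_dist E (vertex_point u) z < real R" by blast
  have walk: "is_walk V E (map q [0..<Suc n])"
    using geodesic_seq_path[OF q] by (simp add: is_path_def del: upt_Suc)
  then have "walk_edges (map q [0..<Suc n]) \<subseteq> E" "set (map q [0..<Suc n]) \<subseteq> V"
    by (auto simp: is_walk_def simp del: upt_Suc)
  from subgraph_vertex_close[OF conn_graph.simple[OF conn_graph_walk[OF simple walk]] this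
      z(1)[unfolded walk_points_def] u(1)]
  obtain w where "w \<in> set (map q [0..<Suc n])" "real (D u w) \<le> graph_dist E (vertex_point u) z" .
  with z(2) show ?thesis unfolding set_map_upt_Suc by force
qed

text \<open>With \<open>R\<close> an integer greater than the stability constant, cycles of length at least \<open>8 R + 4\<close> have
  sides of length at least \<open>4 R\<close>, so that some vertex is at distance at least \<open>2 R\<close> from both
  endpoints.\<close>

lemma chordal_of_stable:
  assumes "vertex_geodesics_stable V E"
  shows "\<exists>\<epsilon> (k::nat) (m::nat). \<epsilon> > 0 \<and> k \<ge> 4 \<and> k \<ge> 2 * m \<and>
       densely_chordal_on V E \<epsilon> k m (geodesic_bigon_cycles V E)"
proof -
  obtain R0 where R0: "0 \<le> R0" "\<And>a b S T. a \<in> V \<Longrightarrow> b \<in> V \<Longrightarrow>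
      is_geodesic V E (vertex_point a) (vertex_point b) S \<Longrightarrow>
      is_geodesic V E (vertex_point a) (vertex_point b) T \<Longrightarrow>
      hausdorff_dist (graph_dist E) T S \<le> R0"
    using assms unfolding vertex_geodesics_stable_def by blast
  define R where "R = nat \<lceil>R0\<rceil> + 1"
  have R: "1 \<le> R" "R0 < real R" unfolding R_def by linarith+
  have "densely_chordal_on V E (real (3 * R + 2)) (8 * R + 4) R (geodesic_bigon_cycles V E)"
    unfolding densely_chordal_on_def
  proof (intro ballI impI)
    fix C assume "C \<in> geodesic_bigon_cycles V E" and long: "8 * R + 4 \<le> walk_length C"
    then obtain n p q where big: "bigon V E C n p q" and len: "walk_length C \<le> 2 * n"
      and geod: "is_geodesic V E (vertex_point (p 0)) (vertex_point (p n)) (walk_points (map p [0..<Suc n]))"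
        "is_geodesic V E (vertex_point (p 0)) (vertex_point (p n)) (walk_points (map q [0..<Suc n]))"
      by (metis bigon_of_cycle)
    interpret bigon V E C n p q by (rule big)
    have on_side: "vertex_point (f i) \<in> walk_points (map f [0..<Suc n])" if "i \<le> n" for f i
      using that unfolding walk_points_def graph_points_def set_map_upt_Suc by blast
    show "\<exists>\<Sigma>. finite \<Sigma> \<and> (\<forall>\<sigma>\<in>\<Sigma>. is_strict_shortcut V E C \<sigma> \<and> walk_length \<sigma> \<le> R) \<and>
       eps_dense (real (3 * R + 2)) (graph_dist (walk_edges C)) (walk_points C)
         (\<Union>\<sigma>\<in>\<Sigma>. {vertex_point (hd \<sigma>), vertex_point (last \<sigma>)})"
    proof (rule dense_shortcuts[OF R(1)])
      show "4 * R \<le> n" using long len by simp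
      fix i assume i: "i \<le> n"
      have V: "p 0 \<in> V" "p n \<in> V" using p_in_V by auto
      show "\<exists>j\<le>n. D (p i) (q j) \<le> R"
        by (rule near_vertex_of_hausdorff[OF geod side(2) R0(2)[OF V geod(2,1)] R(2) p_in_V[OF i] on_side[OF i]])
      show "\<exists>j\<le>n. D (q i) (p j) \<le> R"
        by (rule near_vertex_of_hausdorff[OF geod(2,1) side(1) R0(2)[OF V geod(1,2)] R(2) q_in_V[OF i] on_side[OF i]])
    qed
  qed
  then show ?thesis by (intro exI[of _ "real (3 * R + 2)"] exI[of _ "8 * R + 4"] exI[of _ R]) auto
qed

end

theorem theorem6p7:
  fixes V :: "'a set" and E :: "'a set set"
  assumes "connected_graph V E"
  shows "vertex_geodesics_stable V E \<longleftrightarrow>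
    (\<exists>\<epsilon> (k::nat) (m::nat). \<epsilon> > 0 \<and> k \<ge> 4 \<and> k \<ge> 2 * m \<and>
       densely_chordal_on V E \<epsilon> k m (geodesic_bigon_cycles V E))"
proof -
  interpret conn_graph V E by (rule conn_graph_connected_graph[OF assms])
  show ?thesis using chordal_of_stable stable_of_chordal by blast
qed

end
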